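(* Let $M$ and $N$ be two finite-dimensional smooth manifolds, and let $\varphi : C^\infty(N)\to C^\infty(M)$ be a homomorphism of $\mathbb{R}$-algebras. Then there exists exactly one smooth mapping $\Phi : M\to N$ such that $\Phi^*=\varphi$, i.e. $\varphi(f)=f\circ\Phi$ for all $f\in C^\infty(N)$.
   Context: Manifolds are Hausdorff and second countable (so that Whitney's embedding theorem applies). $C^\infty(M)$ is the $\mathbb{R}$-algebra of smooth real-valued functions on $M$. Algebra homomorphisms are assumed to preserve the identity element. *)

theory Defs
  imports "HOL-Analysis.Analysis" "HOL-Algebra.Module"
begin

text \<open>
  The model space \<open>\<real>\<^sup>n\<close> is the library's \<open>Euclidean_space n\<close>: sequences
  \<open>nat \<Rightarrow> real\<close> vanishing from index \<open>n\<close> on.  The dimension is thus an ordinary natural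
  number, and \<open>n = 0\<close> is included (which a type of class \<open>euclidean_space\<close> would exclude).
\<close>

definition partial_deriv :: "nat \<Rightarrow> ((nat \<Rightarrow> real) \<Rightarrow> real) \<Rightarrow> (nat \<Rightarrow> real) \<Rightarrow> real" where
  "partial_deriv i f x = deriv (\<lambda>t. f (x(i := t))) (x i)"

definition has_partial_deriv :: "nat \<Rightarrow> ((nat \<Rightarrow> real) \<Rightarrow> real) \<Rightarrow> (nat \<Rightarrow> real) \<Rightarrow> bool" where
  "has_partial_deriv i f x \<longleftrightarrow> (\<lambda>t. f (x(i := t))) field_differentiable (at (x i))"

text \<open>
  \<open>Ck_on n k S f\<close>: \<open>f\<close> is of class \<open>C\<^sup>k\<close> on \<open>S\<close>, where \<open>S\<close> is meant to be
  an open subset of \<open>\<real>\<^sup>n\<close>.  The values of \<open>f\<close> outside \<open>S\<close> are then irrelevant.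
\<close>

fun Ck_on :: "nat \<Rightarrow> nat \<Rightarrow> (nat \<Rightarrow> real) set \<Rightarrow> ((nat \<Rightarrow> real) \<Rightarrow> real) \<Rightarrow> bool" where
  "Ck_on n 0 S f \<longleftrightarrow> continuous_map (subtopology (Euclidean_space n) S) euclideanreal f"
| "Ck_on n (Suc k) S f \<longleftrightarrow>
     continuous_map (subtopology (Euclidean_space n) S) euclideanreal f \<and>
     (\<forall>i<n. (\<forall>x\<in>S. has_partial_deriv i f x) \<and> Ck_on n k S (partial_deriv i f))"

definition smooth_on :: "nat \<Rightarrow> (nat \<Rightarrow> real) set \<Rightarrow> ((nat \<Rightarrow> real) \<Rightarrow> real) \<Rightarrow> bool" where
  "smooth_on n S f \<longleftrightarrow> (\<forall>k. Ck_on n k S f)"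

definition smooth_vec_on ::
  "nat \<Rightarrow> nat \<Rightarrow> (nat \<Rightarrow> real) set \<Rightarrow> ((nat \<Rightarrow> real) \<Rightarrow> (nat \<Rightarrow> real)) \<Rightarrow> bool" where
  "smooth_vec_on m n S g \<longleftrightarrow> (\<forall>j<n. smooth_on m S (\<lambda>x. g x j))"

type_synonym 'a chart = "'a set \<times> ('a \<Rightarrow> nat \<Rightarrow> real)"

text \<open>The atlas need not be maximal: all notions below depend only on the smooth structure
  that it generates.\<close>

record 'a manifold =
  mtopology :: "'a topology"
  mdim :: nat
  matlas :: "'a chart set"

abbreviation points :: "'a manifold \<Rightarrow> 'a set" where
  "points M \<equiv> topspace (mtopology M)"

definition is_chart :: "'a topology \<Rightarrow> nat \<Rightarrow> 'a chart \<Rightarrow> bool" where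
  "is_chart X n = (\<lambda>(U, u). openin X U \<and> openin (Euclidean_space n) (u ` U) \<and>
     homeomorphic_map (subtopology X U) (subtopology (Euclidean_space n) (u ` U)) u)"

definition smoothly_compatible :: "nat \<Rightarrow> 'a chart \<Rightarrow> 'a chart \<Rightarrow> bool" where
  "smoothly_compatible n = (\<lambda>(U, u) (V, v).
     smooth_vec_on n n (u ` (U \<inter> V)) (v \<circ> inv_into U u) \<and>
     smooth_vec_on n n (v ` (U \<inter> V)) (u \<circ> inv_into V v))"

definition smooth_manifold :: "'a manifold \<Rightarrow> bool" where
  "smooth_manifold M \<longleftrightarrow>
     Hausdorff_space (mtopology M) \<and> second_countable (mtopology M) \<and>
     (\<forall>c\<in>matlas M. is_chart (mtopology M) (mdim M) c) \<and>
     (\<Union>(U, u)\<in>matlas M. U) = points M \<and>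
     (\<forall>c\<in>matlas M. \<forall>d\<in>matlas M. smoothly_compatible (mdim M) c d)"

text \<open>
  Functions and maps on a manifold are represented by extensional HOL functions (equal to
  \<open>undefined\<close> off the manifold), so that equality is equality as functions on the manifold.
\<close>

definition smooth_functions :: "'a manifold \<Rightarrow> ('a \<Rightarrow> real) set" where
  "smooth_functions M = {f \<in> extensional (points M).
     \<forall>(U, u)\<in>matlas M. smooth_on (mdim M) (u ` U) (f \<circ> inv_into U u)}"

definition smooth_maps :: "'a manifold \<Rightarrow> 'b manifold \<Rightarrow> ('a \<Rightarrow> 'b) set" where
  "smooth_maps M N = {\<Phi> \<in> extensional (points M).
     continuous_map (mtopology M) (mtopology N) \<Phi> \<and>
     (\<forall>(U, u)\<in>matlas M. \<forall>(V, v)\<in>matlas N.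
        smooth_vec_on (mdim M) (mdim N) (u ` {x \<in> U. \<Phi> x \<in> V}) (v \<circ> \<Phi> \<circ> inv_into U u))}"

definition Cinf :: "'a manifold \<Rightarrow> (real, 'a \<Rightarrow> real) module" where
  "Cinf M = \<lparr>carrier = smooth_functions M,
     mult = (\<lambda>f g. \<lambda>x\<in>points M. f x * g x),
     one = (\<lambda>x\<in>points M. 1),
     zero = (\<lambda>x\<in>points M. 0),
     add = (\<lambda>f g. \<lambda>x\<in>points M. f x + g x),
     smult = (\<lambda>c f. \<lambda>x\<in>points M. c * f x)\<rparr>"

text \<open>The library's \<open>ring_hom\<close> preserves sums, products and the identity element.\<close>

definition real_algebra_hom ::
  "(real, 'a) module \<Rightarrow> (real, 'b) module \<Rightarrow> ('a \<Rightarrow> 'b) set" where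
  "real_algebra_hom A B = {h \<in> ring_hom A B.
     \<forall>c. \<forall>a\<in>carrier A. h (c \<odot>\<^bsub>A\<^esub> a) = c \<odot>\<^bsub>B\<^esub> h a}"

end

theory Submission
  imports Defs
begin

text \<open>
  Composing \<open>\<phi>\<close> with evaluation at \<open>x \<in> M\<close> gives a character of \<open>C\<^sup>\<infinity>(N)\<close>, that is, a unital algebra
  homomorphism into \<open>\<real>\<close>.  The heart of the matter is that every such character \<open>\<psi>\<close> is evaluation at a
  point of \<open>N\<close> (\<open>character_is_evaluation\<close>).  The point so attached to \<open>x\<close> is \<open>\<Phi> x\<close>, and then
  \<open>\<phi> f = f \<circ> \<Phi>\<close> by construction.

  A function without zeros is invertible, so every function in the kernel of \<open>\<psi>\<close> has a zero.  If \<open>\<psi>\<close>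
  is not evaluation at any point, then near each point some nonnegative function in the kernel, a
  multiple of a square \<open>(f - \<psi> f)\<^sup>2\<close>, exceeds 1; as \<open>N\<close> is Lindelof, countably many such functions
  \<open>g 0, g 1, \<dots>\<close> suffice for all of \<open>N\<close>.  The usual argument takes a proper function in order to
  pass to finitely many of them.  Here the \<open>g i\<close> themselves provide a substitute
  (\<open>countable_kernel_bounded_at_some_point\<close>): the locally finite sum
  \<open>h = (\<Sum>j. \<Prod>i\<le>j. e (1 - g i) / e (1/2))\<close>, where \<open>e t = exp (-1/t)\<close> for positive \<open>t\<close> and \<open>e t = 0\<close>
  otherwise, is smooth, and it is at least \<open>j\<close> wherever \<open>g 0, \<dots>, g j\<close> all vanish.  For
  \<open>j > \<psi> h\<close> the function \<open>g 0 + \<dots> + g j + (h - \<psi> h)\<^sup>2\<close> lies in the kernel and has no zero, a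
  contradiction.

  Bump functions supported in a chart do the rest.  They show that \<open>C\<^sup>\<infinity>(N)\<close> separates points, which
  gives uniqueness (\<open>smooth_functions_separate\<close>).  They also show that a map pulling smooth functions
  back to smooth functions is smooth (\<open>smooth_mapsI_pullback\<close>): it is continuous because the sets where
  a bump function is positive form a base of the topology, and in a chart \<open>v\<close> near \<open>\<Phi> x\<close> its
  coordinates are the quotients \<open>((b * v\<^sub>j) \<circ> \<Phi>) / (b \<circ> \<Phi>)\<close> of pulled back smooth functions, where \<open>b\<close>
  is a bump function at \<open>\<Phi> x\<close>.

  That a product of a bump function with a function on its chart is smooth in all other charts rests on
  the chain rule for functions of class \<open>C\<^sup>k\<close>, which is proved for the definition by partial
  derivatives.
\<close>

section \<open>The class of k times continuously differentiable functions\<close>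

text \<open>
  A basic open set of the product topology restricts only finitely many coordinates, and those from \<open>n\<close>
  on are zero throughout; so open sets of Euclidean space can be handled by boxes in \<open>n\<close> coordinates.
\<close>

lemma openin_Euclidean_space_imp_box:
  assumes S: "openin (Euclidean_space n) S" and a: "a \<in> S"
  obtains \<delta> where "\<delta> > 0"
    "\<And>y. y \<in> topspace (Euclidean_space n) \<Longrightarrow> (\<And>i. i < n \<Longrightarrow> \<bar>y i - a i\<bar> < \<delta>) \<Longrightarrow> y \<in> S"
proof -
  obtain T where T: "openin (powertop_real UNIV) T" "S = T \<inter> {x. \<forall>i\<ge>n. x i = 0}"
    using S by (auto simp: Euclidean_space_def openin_subtopology)
  then obtain U where U: "\<And>i::nat. open (U i)" "a \<in> Pi\<^sub>E UNIV U" "Pi\<^sub>E UNIV U \<subseteq> T"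
    using a unfolding openin_product_topology_alt by fastforce
  have "\<forall>\<^sub>F \<delta> in at_right (0::real). \<forall>y. \<bar>y - a i\<bar> < \<delta> \<longrightarrow> y \<in> U i" for i
  proof -
    obtain e where e: "e > 0" "\<And>y. dist y (a i) < e \<Longrightarrow> y \<in> U i"
      using U(1)[of i] U(2) unfolding open_dist by (metis PiE_E UNIV_I)
    show ?thesis
      unfolding eventually_at_right_field using e by (force simp: dist_real_def)
  qed
  then have "\<forall>\<^sub>F \<delta> in at_right (0::real). \<forall>i\<in>{..<n}. \<forall>y. \<bar>y - a i\<bar> < \<delta> \<longrightarrow> y \<in> U i"
    by (intro eventually_ball_finite) auto
  then have "\<forall>\<^sub>F \<delta> in at_right (0::real). \<delta> > 0 \<and> (\<forall>i\<in>{..<n}. \<forall>y. \<bar>y - a i\<bar> < \<delta> \<longrightarrow> y \<in> U i)"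
    using eventually_at_right_less eventually_conj by blast
  then obtain \<delta> where \<delta>: "\<delta> > 0" "\<forall>i\<in>{..<n}. \<forall>y. \<bar>y - a i\<bar> < \<delta> \<longrightarrow> y \<in> U i"
    using eventually_happens trivial_limit_at_right_real by blast
  show thesis
  proof (rule that[OF \<delta>(1)])
    fix y assume y: "y \<in> topspace (Euclidean_space n)" "\<And>i. i < n \<Longrightarrow> \<bar>y i - a i\<bar> < \<delta>"
    have "y i \<in> U i" for i
    proof (cases "i < n")
      case False
      then have "y i = a i"
        using y(1) a T(2) by (auto simp: topspace_Euclidean_space)
      then show ?thesis using U(2) by auto
    qed (use \<delta>(2) y(2) in auto)
    then show "y \<in> S"
      using U(3) T(2) y(1) by (auto simp: topspace_Euclidean_space)
  qed
qed

lemma eventually_curve_in_openin: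
  assumes S: "openin (Euclidean_space n) S" and "\<gamma> t0 \<in> S"
    and "\<And>i. i < n \<Longrightarrow> isCont (\<lambda>t. \<gamma> t i) t0"
    and "\<forall>\<^sub>F t in nhds t0. \<gamma> t \<in> topspace (Euclidean_space n)"
  shows "\<forall>\<^sub>F t in nhds (t0::real). \<gamma> t \<in> S"
proof -
  obtain \<delta> where \<delta>: "\<delta> > 0"
    "\<And>y. y \<in> topspace (Euclidean_space n) \<Longrightarrow> (\<And>i. i < n \<Longrightarrow> \<bar>y i - \<gamma> t0 i\<bar> < \<delta>) \<Longrightarrow> y \<in> S"
    using openin_Euclidean_space_imp_box[OF assms(1,2)] by metis
  have "\<forall>\<^sub>F t in nhds t0. \<forall>i\<in>{..<n}. \<bar>\<gamma> t i - \<gamma> t0 i\<bar> < \<delta>"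
  proof (intro eventually_ball_finite ballI)
    fix i assume "i \<in> {..<n}"
    then have "((\<lambda>t. \<gamma> t i) \<longlongrightarrow> \<gamma> t0 i) (nhds t0)"
      using assms(3)[of i] tendsto_at_iff_tendsto_nhds[of "\<lambda>t. \<gamma> t i" t0] by (simp add: isCont_def)
    from tendstoD[OF this \<delta>(1)] show "\<forall>\<^sub>F t in nhds t0. \<bar>\<gamma> t i - \<gamma> t0 i\<bar> < \<delta>"
      by (simp add: dist_real_def)
  qed auto
  with assms(4) show ?thesis
    by eventually_elim (use \<delta>(2) in auto)
qed

text \<open>
  Partial derivatives at a point of an open set therefore depend only on the values in that set.
\<close>

lemma eventually_line_in_openin:
  assumes S: "openin (Euclidean_space n) S" and x: "x \<in> S" and i: "i < n"
  shows "\<forall>\<^sub>F t in nhds (x i). x(i := t) \<in> S"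
proof (rule eventually_curve_in_openin[OF S])
  have "x \<in> topspace (Euclidean_space n)"
    using openin_subset[OF S] x by auto
  then show "\<forall>\<^sub>F t in nhds (x i). x(i := t) \<in> topspace (Euclidean_space n)"
    using i by (auto simp: topspace_Euclidean_space)
  show "isCont (\<lambda>t. (x(i := t)) j) (x i)" for j
    by (cases "j = i") auto
qed (use x in auto)

lemma has_partial_deriv_cong:
  assumes "openin (Euclidean_space n) S" "x \<in> S" "i < n" "\<And>y. y \<in> S \<Longrightarrow> f y = g y"
  shows "has_partial_deriv i f x \<longleftrightarrow> has_partial_deriv i g x"
    and "partial_deriv i f x = partial_deriv i g x"
proof -
  have ev: "\<forall>\<^sub>F t in nhds (x i). f (x(i := t)) = g (x(i := t))"
    using eventually_line_in_openin[OF assms(1-3)] by eventually_elim (use assms(4) in auto)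
  show "has_partial_deriv i f x \<longleftrightarrow> has_partial_deriv i g x"
    unfolding has_partial_deriv_def field_differentiable_def
    using DERIV_cong_ev[OF refl ev refl] by simp
  show "partial_deriv i f x = partial_deriv i g x"
    unfolding partial_deriv_def by (rule deriv_cong_ev[OF ev refl])
qed

lemma has_partial_deriv_DERIV:
  assumes "has_partial_deriv i f x"
  shows "((\<lambda>t. f (x(i := t))) has_real_derivative partial_deriv i f x) (at (x i))"
  using assms unfolding has_partial_deriv_def partial_deriv_def
  by (simp add: field_differentiable_derivI)

lemma has_partial_derivI:
  assumes "((\<lambda>t. f (x(i := t))) has_real_derivative D) (at (x i))"
  shows "has_partial_deriv i f x" "partial_deriv i f x = D"
  using assms unfolding has_partial_deriv_def partial_deriv_def field_differentiable_def
  by (auto intro: DERIV_imp_deriv)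

lemma Ck_on_imp_continuous:
  "Ck_on n k S f \<Longrightarrow> continuous_map (subtopology (Euclidean_space n) S) euclideanreal f"
  by (cases k) auto

lemma Ck_on_cong:
  assumes "openin (Euclidean_space n) S" "\<And>y. y \<in> S \<Longrightarrow> f y = g y"
  shows "Ck_on n k S f \<longleftrightarrow> Ck_on n k S g"
  using assms(2)
proof (induction k arbitrary: f g)
  case (Suc k)
  have c: "continuous_map (subtopology (Euclidean_space n) S) euclideanreal f \<longleftrightarrow>
    continuous_map (subtopology (Euclidean_space n) S) euclideanreal g"
    using Suc.prems by (auto intro: continuous_map_eq)
  have "(\<forall>x\<in>S. has_partial_deriv i f x) \<longleftrightarrow> (\<forall>x\<in>S. has_partial_deriv i g x)" if "i < n" for i
    using has_partial_deriv_cong(1)[OF assms(1) _ that, of _ f g] Suc.prems by blast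
  moreover have "Ck_on n k S (partial_deriv i f) \<longleftrightarrow> Ck_on n k S (partial_deriv i g)" if "i < n" for i
    using has_partial_deriv_cong(2)[OF assms(1) _ that, of _ f g] Suc.prems by (intro Suc.IH) blast
  ultimately show ?case using c by auto
qed (auto intro: continuous_map_eq)

lemma Ck_on_mono:
  assumes "Ck_on n k S f" "T \<subseteq> S"
  shows "Ck_on n k T f"
  using assms(1)
proof (induction k arbitrary: f)
  case (Suc k)
  then show ?case
    using assms(2) by (auto intro: continuous_map_from_subtopology_mono)
qed (use assms(2) in \<open>auto intro: continuous_map_from_subtopology_mono\<close>)

lemma continuous_map_locally_openin:
  assumes "openin X S"
    and loc: "\<And>x. x \<in> S \<Longrightarrow> \<exists>T. openin X T \<and> x \<in> T \<and> T \<subseteq> S \<and> continuous_map (subtopology X T) Y f"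
  shows "continuous_map (subtopology X S) Y f"
  unfolding continuous_map_alt
proof (intro conjI allI impI)
  have S: "S \<subseteq> topspace X" by (rule openin_subset[OF assms(1)])
  show "f \<in> topspace (subtopology X S) \<rightarrow> topspace Y"
  proof
    fix x assume "x \<in> topspace (subtopology X S)"
    then show "f x \<in> topspace Y"
      using loc[of x] S unfolding continuous_map_def by (auto simp: Pi_iff)
  qed
  fix U assume U: "openin Y U"
  have "openin X (f -` U \<inter> S)"
  proof (subst openin_subopen, intro ballI)
    fix x assume x: "x \<in> f -` U \<inter> S"
    then obtain T where T: "openin X T" "x \<in> T" "T \<subseteq> S" "continuous_map (subtopology X T) Y f"
      using loc by blast
    then have "openin (subtopology X T) {x \<in> topspace (subtopology X T). f x \<in> U}"
      using U openin_continuous_map_preimage by blast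
    then have "openin X {x \<in> topspace (subtopology X T). f x \<in> U}"
      using T(1) openin_trans_full by blast
    then show "\<exists>T. openin X T \<and> x \<in> T \<and> T \<subseteq> f -` U \<inter> S"
      using x T S by (intro exI[of _ "{x \<in> topspace (subtopology X T). f x \<in> U}"]) auto
  qed
  then show "openin (subtopology X S) (f -` U \<inter> topspace (subtopology X S))"
    using S assms(1) by (simp add: openin_open_subtopology Int_absorb1)
qed

lemma Ck_on_local:
  assumes "openin (Euclidean_space n) S"
    and "\<And>x. x \<in> S \<Longrightarrow> \<exists>T. openin (Euclidean_space n) T \<and> x \<in> T \<and> T \<subseteq> S \<and> Ck_on n k T f"
  shows "Ck_on n k S f"
  using assms(2)
proof (induction k arbitrary: f)
  case 0
  then show ?case by (auto intro: continuous_map_locally_openin[OF assms(1)])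
next
  case (Suc k)
  have "continuous_map (subtopology (Euclidean_space n) S) euclideanreal f"
    using Suc.prems Ck_on_imp_continuous by (intro continuous_map_locally_openin[OF assms(1)]) meson
  moreover have "has_partial_deriv i f x" if "i < n" "x \<in> S" for i x
    using Suc.prems[OF that(2)] that(1) by auto
  moreover have "Ck_on n k S (partial_deriv i f)" if "i < n" for i
    using Suc.prems that by (intro Suc.IH) (metis Ck_on.simps(2))
  ultimately show ?case by simp
qed

lemma Ck_on_const: "Ck_on n k S (\<lambda>x. c)"
proof (induction k arbitrary: c)
  case (Suc k)
  have "has_partial_deriv i (\<lambda>x. c) x" "partial_deriv i (\<lambda>x. c) = (\<lambda>x. 0)" for i x
    using has_partial_derivI[of "\<lambda>x. c" _ i 0] by (auto intro!: ext)
  then show ?case using Suc.IH[of 0] by simp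
qed simp

lemma Ck_on_coord:
  assumes "j < n"
  shows "Ck_on n k S (\<lambda>x. x j)"
proof -
  have c: "continuous_map (subtopology (Euclidean_space n) S) euclideanreal (\<lambda>x. x j)"
    unfolding Euclidean_space_def
    by (intro continuous_map_from_subtopology continuous_map_product_coordinates) auto
  show ?thesis
  proof (cases k)
    case (Suc k')
    have D: "((\<lambda>t. (x(i := t)) j) has_real_derivative (if i = j then 1 else 0)) (at (x i))" for i x
      by (auto intro!: derivative_eq_intros)
    have "has_partial_deriv i (\<lambda>x. x j) x"
      "partial_deriv i (\<lambda>x. x j) = (\<lambda>x. if i = j then 1 else 0)" for i x
      by (rule has_partial_derivI(1)[where f = "\<lambda>x. x j", OF D],
          rule ext, rule has_partial_derivI(2)[where f = "\<lambda>x. x j", OF D])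
    then show ?thesis using c Ck_on_const by (simp add: Suc)
  qed (use c in simp)
qed

lemma Ck_on_SucD_lower:
  "Ck_on n (Suc k) S f \<Longrightarrow> Ck_on n k S f"
  by (induction k arbitrary: f) auto

text \<open>
  The values of \<open>partial_deriv i f\<close> outside \<open>S\<close> are of no interest, so it is enough to know some
  function \<open>D i\<close> that gives the derivative on \<open>S\<close>.  The closure under sums, products and compositions
  then follows by induction on \<open>k\<close>.
\<close>

lemma Ck_on_SucI:
  assumes S: "openin (Euclidean_space n) S"
    and "continuous_map (subtopology (Euclidean_space n) S) euclideanreal f"
    and D: "\<And>i x. i < n \<Longrightarrow> x \<in> S \<Longrightarrow> ((\<lambda>t. f (x(i := t))) has_real_derivative D i x) (at (x i))"
    and k: "\<And>i. i < n \<Longrightarrow> Ck_on n k S (D i)"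
  shows "Ck_on n (Suc k) S f"
proof -
  have "partial_deriv i f x = D i x" if "i < n" "x \<in> S" for i x
    using has_partial_derivI(2)[OF D[OF that]] .
  then have "Ck_on n k S (partial_deriv i f)" if "i < n" for i
    using k[OF that] Ck_on_cong[OF S, of "partial_deriv i f" "D i"] that by blast
  then show ?thesis
    using assms(2) has_partial_derivI(1)[where f = f, OF D] by auto
qed

lemma Ck_on_SucD:
  assumes "Ck_on n (Suc k) S f" "i < n"
  shows "Ck_on n k S (partial_deriv i f)"
    and "x \<in> S \<Longrightarrow> ((\<lambda>t. f (x(i := t))) has_real_derivative partial_deriv i f x) (at (x i))"
  using assms has_partial_deriv_DERIV by auto

lemma Ck_on_add:
  assumes S: "openin (Euclidean_space n) S" and "Ck_on n k S f" "Ck_on n k S g"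
  shows "Ck_on n k S (\<lambda>x. f x + g x)"
  using assms(2,3)
proof (induction k arbitrary: f g)
  case (Suc k)
  show ?case
  proof (rule Ck_on_SucI[OF S])
    fix i assume i: "i < n"
    show "Ck_on n k S (\<lambda>x. partial_deriv i f x + partial_deriv i g x)"
      using Suc.IH Ck_on_SucD(1)[OF _ i] Suc.prems by blast
    show "((\<lambda>t. f (x(i := t)) + g (x(i := t))) has_real_derivative
        partial_deriv i f x + partial_deriv i g x) (at (x i))" if "x \<in> S" for x
      by (rule DERIV_add) (use Ck_on_SucD(2)[OF _ i that] Suc.prems in blast)+
  qed (use Suc.prems in \<open>auto intro: continuous_map_add\<close>)
qed (auto intro: continuous_map_add)

lemma Ck_on_mult:
  assumes S: "openin (Euclidean_space n) S" and "Ck_on n k S f" "Ck_on n k S g"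
  shows "Ck_on n k S (\<lambda>x. f x * g x)"
  using assms(2,3)
proof (induction k arbitrary: f g)
  case (Suc k)
  show ?case
  proof (rule Ck_on_SucI[OF S])
    fix i assume i: "i < n"
    show "Ck_on n k S (\<lambda>x. partial_deriv i f x * g x + f x * partial_deriv i g x)"
      using Suc.IH Ck_on_SucD(1)[OF _ i] Ck_on_SucD_lower Suc.prems
      by (intro Ck_on_add[OF S]) blast+
    show "((\<lambda>t. f (x(i := t)) * g (x(i := t))) has_real_derivative
        partial_deriv i f x * g x + f x * partial_deriv i g x) (at (x i))" if "x \<in> S" for x
      using DERIV_mult[OF Ck_on_SucD(2)[OF Suc.prems(1) i that] Ck_on_SucD(2)[OF Suc.prems(2) i that]]
      by (simp add: algebra_simps del: fun_upd_apply)
  qed (use Suc.prems in \<open>auto intro: continuous_map_real_mult\<close>)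
qed (auto intro: continuous_map_real_mult)

lemma Ck_on_sum:
  assumes S: "openin (Euclidean_space n) S" and "\<And>j. j \<in> J \<Longrightarrow> Ck_on n k S (f j)"
  shows "Ck_on n k S (\<lambda>x. \<Sum>j\<in>J. f j x)"
  using assms(2) by (induction J rule: infinite_finite_induct) (auto intro: Ck_on_const Ck_on_add[OF S])

lemma Ck_on_prod:
  assumes S: "openin (Euclidean_space n) S" and "\<And>j. j \<in> J \<Longrightarrow> Ck_on n k S (f j)"
  shows "Ck_on n k S (\<lambda>x. \<Prod>j\<in>J. f j x)"
  using assms(2) by (induction J rule: infinite_finite_induct) (auto intro: Ck_on_const Ck_on_mult[OF S])

text \<open>
  A class \<open>F\<close> of functions of one variable that is closed under differentiation on \<open>A\<close> consists of smooth
  functions.  Stating the hypothesis for the whole class makes the induction on \<open>k\<close> immediate, and in the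
  applications the class is easier to describe than the iterated derivatives.
\<close>

lemma Ck_on_compose_real:
  assumes S: "openin (Euclidean_space n) S"
    and F: "\<And>s. s \<in> F \<Longrightarrow> \<exists>s'\<in>F. \<forall>y\<in>A. (s has_real_derivative s' y) (at y)"
    and "s \<in> F" "\<And>x. x \<in> S \<Longrightarrow> f x \<in> A" "Ck_on n k S f"
  shows "Ck_on n k S (\<lambda>x. s (f x))"
proof -
  have cont: "continuous_map (subtopology (Euclidean_space n) S) euclideanreal (\<lambda>x. s (f x))"
    if "s \<in> F" "continuous_map (subtopology (Euclidean_space n) S) euclideanreal f" for s
  proof -
    have "continuous_on A s"
      using F[OF that(1)] by (meson DERIV_isCont continuous_at_imp_continuous_on)
    then have "continuous_map (top_of_set A) euclideanreal s" by simp
    moreover have "continuous_map (subtopology (Euclidean_space n) S) (top_of_set A) f"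
      using that(2) assms(4) by (auto simp: continuous_map_in_subtopology)
    ultimately show ?thesis
      using continuous_map_compose[of _ _ f _ s] by (simp add: o_def)
  qed
  show ?thesis
    using assms(3,5)
  proof (induction k arbitrary: s)
    case 0
    then show ?case using cont by simp
  next
    case (Suc k)
    obtain s' where s': "s' \<in> F" "\<forall>y\<in>A. (s has_real_derivative s' y) (at y)"
      using F[OF Suc.prems(1)] by auto
    show ?case
    proof (rule Ck_on_SucI[OF S])
      fix i assume i: "i < n"
      show "Ck_on n k S (\<lambda>x. s' (f x) * partial_deriv i f x)"
        using Suc.IH[OF s'(1)] Suc.prems(2) i Ck_on_SucD_lower Ck_on_SucD(1) by (intro Ck_on_mult[OF S]) blast+
      fix x assume x: "x \<in> S"
      show "((\<lambda>t. s (f (x(i := t)))) has_real_derivative s' (f x) * partial_deriv i f x) (at (x i))"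
        using DERIV_chain2[of s "s' (f x)" "\<lambda>t. f (x(i := t))" "x i"] s'(2) assms(4)[OF x]
          Ck_on_SucD(2)[OF Suc.prems(2) i x] by (simp del: fun_upd_apply)
    qed (use Suc.prems cont in auto)
  qed
qed

lemma Ck_on_inverse:
  assumes S: "openin (Euclidean_space n) S" and "Ck_on n k S f" "\<And>x. x \<in> S \<Longrightarrow> f x \<noteq> 0"
  shows "Ck_on n k S (\<lambda>x. inverse (f x))"
proof -
  define F where "F = range (\<lambda>cm (y::real). fst cm * inverse y ^ snd cm)"
  have "\<exists>s'\<in>F. \<forall>y\<in>-{0}. (s has_real_derivative s' y) (at y)" if "s \<in> F" for s
  proof -
    from that obtain c m where s: "s = (\<lambda>y. c * inverse y ^ m)"
      unfolding F_def by auto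
    have "(s has_real_derivative (- c * m) * inverse y ^ Suc m) (at y)" if "y \<noteq> 0" for y
    proof -
      have "(s has_real_derivative c * (real m * (- (inverse y ^ Suc (Suc 0)) * inverse y ^ (m - Suc 0)))) (at y)"
        unfolding s by (intro DERIV_cmult DERIV_power DERIV_inverse that)
      then show ?thesis by (cases m) (simp_all add: algebra_simps)
    qed
    moreover have "(\<lambda>y. (- c * m) * inverse y ^ Suc m) \<in> F"
      unfolding F_def by (rule image_eqI[of _ _ "(- c * m, Suc m)"]) auto
    ultimately show ?thesis by (intro bexI) auto
  qed
  moreover have "inverse \<in> F"
    unfolding F_def by (rule image_eqI[of _ _ "(1, 1)"]) auto
  ultimately show ?thesis
    using Ck_on_compose_real[OF S, of F "-{0}" inverse f k] assms by auto
qed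

section \<open>The chain rule in several variables\<close>

text \<open>
  The increment \<open>f (\<gamma> t) - f (\<gamma> t0)\<close> telescopes over the points \<open>z k t\<close> that have their first \<open>k\<close>
  coordinates from \<open>\<gamma> t\<close> and the others from \<open>\<gamma> t0\<close>.  The \<open>k\<close>-th step changes a single coordinate, so the
  mean value inequality compares it with \<open>D k (\<gamma> t0)\<close> times the increment of that coordinate; this is
  where continuity of the partial derivative is used.
\<close>

lemma has_real_derivative_compose_C1:
  assumes S: "openin (Euclidean_space n) S"
    and D: "\<And>i x. i < n \<Longrightarrow> x \<in> S \<Longrightarrow> ((\<lambda>t. f (x(i := t))) has_real_derivative D i x) (at (x i))"
    and cD: "\<And>i. i < n \<Longrightarrow> continuous_map (subtopology (Euclidean_space n) S) euclideanreal (D i)"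
    and a: "\<gamma> t0 \<in> S"
    and \<gamma>: "\<forall>\<^sub>F t in nhds t0. \<gamma> t \<in> topspace (Euclidean_space n)"
    and \<gamma>': "\<And>i. i < n \<Longrightarrow> ((\<lambda>t. \<gamma> t i) has_real_derivative d i) (at t0)"
  shows "((\<lambda>t. f (\<gamma> t)) has_real_derivative (\<Sum>i<n. D i (\<gamma> t0) * d i)) (at t0)"
proof -
  define a where "a = \<gamma> t0"
  define z where "z k t = (\<lambda>i. if i < k then \<gamma> t i else a i)" for k t
  have aE: "a \<in> topspace (Euclidean_space n)"
    using openin_subset[OF S] \<open>\<gamma> t0 \<in> S\<close> a_def by blast
  have S_top: "S \<subseteq> topspace (Euclidean_space n)"
    by (rule openin_subset[OF S])
  have step: "((\<lambda>t. (f (z (Suc k) t) - f (z k t)) / (t - t0)) \<longlongrightarrow> D k a * d k) (at t0)"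
    if k: "k < n" for k
  proof -
    \<comment> \<open>The difference quotient in coordinate \<open>k\<close>, filled in by its limit where that coordinate does not move.\<close>
    define Q where "Q t = (if \<gamma> t k = a k then D k a
      else (f (z (Suc k) t) - f (z k t)) / (\<gamma> t k - a k))" for t
    have "(Q \<longlongrightarrow> D k a) (at t0)"
    proof (rule tendstoI)
      fix e :: real assume e: "e > 0"
      define W where "W = {y \<in> S. D k y \<in> ball (D k a) (e/2)}"
      have "{y \<in> topspace (subtopology (Euclidean_space n) S). D k y \<in> ball (D k a) (e/2)} = W"
        using S_top by (auto simp: W_def)
      moreover have "openin (subtopology (Euclidean_space n) S)
          {y \<in> topspace (subtopology (Euclidean_space n) S). D k y \<in> ball (D k a) (e/2)}"
        by (rule openin_continuous_map_preimage[OF cD[OF k]]) auto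
      ultimately have "openin (subtopology (Euclidean_space n) S) W"
        by (rule subst)
      then have "openin (Euclidean_space n) W"
        using S by (rule openin_trans_full)
      moreover have "a \<in> W"
        using \<open>\<gamma> t0 \<in> S\<close> e by (simp add: a_def W_def)
      ultimately obtain \<delta> where \<delta>: "\<delta> > 0"
        and W: "\<And>y. y \<in> topspace (Euclidean_space n) \<Longrightarrow> (\<And>i. i < n \<Longrightarrow> \<bar>y i - a i\<bar> < \<delta>) \<Longrightarrow> y \<in> W"
        using openin_Euclidean_space_imp_box[of n W a] by metis
      have "\<forall>\<^sub>F t in at t0. \<forall>i\<in>{..<n}. \<bar>\<gamma> t i - a i\<bar> < \<delta>"
      proof (intro eventually_ball_finite ballI)
        fix i assume "i \<in> {..<n}"
        then have "((\<lambda>t. \<gamma> t i) \<longlongrightarrow> a i) (at t0)"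
          using DERIV_isCont[OF \<gamma>'] by (simp add: isCont_def a_def)
        from tendstoD[OF this \<delta>] show "\<forall>\<^sub>F t in at t0. \<bar>\<gamma> t i - a i\<bar> < \<delta>"
          by (simp add: dist_real_def)
      qed auto
      moreover have "\<forall>\<^sub>F t in at t0. \<gamma> t \<in> topspace (Euclidean_space n)"
        using \<gamma> by (auto simp: eventually_at_filter elim: eventually_mono)
      ultimately show "\<forall>\<^sub>F t in at t0. dist (Q t) (D k a) < e"
      proof eventually_elim
        case (elim t)
        show ?case
        proof (cases "\<gamma> t k = a k")
          case True
          then show ?thesis using e by (simp add: Q_def)
        next
          case False
          define w where "w s = (z k t)(k := s)" for s
          have w: "w (\<gamma> t k) = z (Suc k) t" "w (a k) = z k t"
            by (auto simp: w_def z_def fun_eq_iff)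
          have near: "w s \<in> S \<and> \<bar>D k (w s) - D k a\<bar> < e/2"
            if "s \<in> closed_segment (a k) (\<gamma> t k)" for s
          proof -
            have "w s \<in> W"
            proof (rule W)
              show "w s \<in> topspace (Euclidean_space n)"
                using aE elim(2) k by (auto simp: w_def z_def topspace_Euclidean_space)
              fix i assume "i < n"
              moreover have "\<bar>s - a k\<bar> < \<delta>"
              proof -
                have "\<bar>\<gamma> t k - a k\<bar> < \<delta>" using elim(1) k by simp
                then show ?thesis using that by (auto simp: closed_segment_eq_real_ivl split: if_splits)
              qed
              ultimately show "\<bar>w s i - a i\<bar> < \<delta>"
                using elim(1) \<delta> by (auto simp: w_def z_def)
            qed
            then show ?thesis
              by (auto simp: W_def dist_real_def abs_minus_commute)
          qed
          have "norm ((\<lambda>s. f (w s) - D k a * s) (\<gamma> t k) - (\<lambda>s. f (w s) - D k a * s) (a k))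
            \<le> (e/2) * norm (\<gamma> t k - a k)"
          proof (rule field_differentiable_bound)
            show "convex (closed_segment (a k) (\<gamma> t k))" by simp
            fix s assume s: "s \<in> closed_segment (a k) (\<gamma> t k)"
            have "((\<lambda>s'. f ((w s)(k := s'))) has_real_derivative D k (w s)) (at (w s k))"
              using D[OF k] near[OF s] by blast
            then have "((\<lambda>s'. f (w s')) has_real_derivative D k (w s)) (at s)"
              by (simp add: w_def)
            then show "((\<lambda>s. f (w s) - D k a * s) has_field_derivative D k (w s) - D k a)
                (at s within closed_segment (a k) (\<gamma> t k))"
              by (intro has_field_derivative_at_within[OF DERIV_diff] DERIV_cmult_Id)
            show "norm (D k (w s) - D k a) \<le> e/2"
              using near[OF s] by simp
          qed auto
          then have "\<bar>f (z (Suc k) t) - f (z k t) - D k a * (\<gamma> t k - a k)\<bar> \<le> (e/2) * \<bar>\<gamma> t k - a k\<bar>"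
            by (simp add: w algebra_simps)
          moreover have "Q t - D k a = (f (z (Suc k) t) - f (z k t) - D k a * (\<gamma> t k - a k)) / (\<gamma> t k - a k)"
            using False by (simp add: Q_def field_simps)
          ultimately have "\<bar>Q t - D k a\<bar> \<le> e/2"
            using False by (simp add: abs_divide pos_divide_le_eq)
          then show ?thesis using e by (simp add: dist_real_def)
        qed
      qed
    qed
    moreover have "((\<lambda>t. (\<gamma> t k - a k) / (t - t0)) \<longlongrightarrow> d k) (at t0)"
      using \<gamma>'[OF k] by (simp add: has_field_derivative_iff a_def)
    ultimately have "((\<lambda>t. Q t * ((\<gamma> t k - a k) / (t - t0))) \<longlongrightarrow> D k a * d k) (at t0)"
      by (rule tendsto_mult)
    moreover have "Q t * ((\<gamma> t k - a k) / (t - t0)) = (f (z (Suc k) t) - f (z k t)) / (t - t0)" for t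
    proof (cases "\<gamma> t k = a k")
      case True
      then have "z (Suc k) t = z k t"
        by (auto simp: z_def fun_eq_iff less_Suc_eq)
      then show ?thesis using True by simp
    qed (simp add: Q_def)
    ultimately show ?thesis by (simp only:)
  qed
  have "((\<lambda>t. \<Sum>k<n. (f (z (Suc k) t) - f (z k t)) / (t - t0)) \<longlongrightarrow> (\<Sum>k<n. D k a * d k)) (at t0)"
    by (intro tendsto_sum step) auto
  moreover have "\<forall>\<^sub>F t in at t0. (\<Sum>k<n. (f (z (Suc k) t) - f (z k t)) / (t - t0))
      = (f (\<gamma> t) - f (\<gamma> t0)) / (t - t0)"
  proof -
    have "\<forall>\<^sub>F t in at t0. \<gamma> t \<in> topspace (Euclidean_space n)"
      using \<gamma> by (auto simp: eventually_at_filter elim: eventually_mono)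
    then show ?thesis
    proof eventually_elim
      case (elim t)
      have "z n t = \<gamma> t"
        using elim aE by (auto simp: z_def fun_eq_iff topspace_Euclidean_space)
      moreover have "z 0 t = \<gamma> t0"
        by (simp add: z_def a_def)
      ultimately show ?case
        using sum_lessThan_telescope[of "\<lambda>k. f (z k t)" n]
        by (simp flip: sum_divide_distrib)
    qed
  qed
  ultimately show ?thesis
    unfolding has_field_derivative_iff a_def[symmetric]
    by (rule Lim_transform_eventually)
qed

text \<open>
  Each partial derivative of the composite is a sum of products of a composite \<open>partial_deriv j f (g x)\<close>
  with a partial derivative of \<open>g\<close>, to which the induction hypothesis applies.  The coordinates of \<open>g x\<close>
  from \<open>n\<close> on vanish because \<open>T\<close> lies in \<open>\<real>\<^sup>n\<close>.
\<close>

lemma Ck_on_compose: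
  assumes S: "openin (Euclidean_space m) S" and T: "openin (Euclidean_space n) T"
    and ST: "\<And>x. x \<in> S \<Longrightarrow> g x \<in> T"
    and g: "\<And>j. j < n \<Longrightarrow> Ck_on m k S (\<lambda>x. g x j)" and f: "Ck_on n k T f"
  shows "Ck_on m k S (\<lambda>x. f (g x))"
  using g f
proof (induction k arbitrary: f)
  have T_top: "T \<subseteq> topspace (Euclidean_space n)"
    by (rule openin_subset[OF T])
  have cont: "continuous_map (subtopology (Euclidean_space m) S) euclideanreal (\<lambda>x. f (g x))"
    if g: "\<And>j. j < n \<Longrightarrow> continuous_map (subtopology (Euclidean_space m) S) euclideanreal (\<lambda>x. g x j)"
      and f: "continuous_map (subtopology (Euclidean_space n) T) euclideanreal f" for f
  proof -
    have g0: "g x j = 0" if "x \<in> S" "\<not> j < n" for x j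
      using ST[OF that(1)] T_top that(2) by (auto simp: topspace_Euclidean_space)
    have "continuous_map (subtopology (Euclidean_space m) S) euclideanreal (\<lambda>x. g x j)" for j
    proof (cases "j < n")
      case False
      have "continuous_map (subtopology (Euclidean_space m) S) euclideanreal (\<lambda>x. 0)"
        by simp
      then show ?thesis
        by (rule continuous_map_eq) (use g0[OF _ False] in simp)
    qed (rule g)
    then have "continuous_map (subtopology (Euclidean_space m) S) (Euclidean_space n) g"
      unfolding Euclidean_space_def[of n] continuous_map_in_subtopology
      unfolding continuous_map_componentwise_UNIV using g0 by (auto simp: not_less)
    then have "continuous_map (subtopology (Euclidean_space m) S) (subtopology (Euclidean_space n) T) g"
      using ST by (auto simp: continuous_map_in_subtopology)
    then show ?thesis
      using continuous_map_compose[OF _ f] by (simp add: o_def)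
  qed
  {
    case 0
    then show ?case using cont by simp
  next
    case (Suc k)
    show ?case
    proof (rule Ck_on_SucI[OF S])
      show "continuous_map (subtopology (Euclidean_space m) S) euclideanreal (\<lambda>x. f (g x))"
        by (rule cont) (use Suc.prems Ck_on_imp_continuous in blast)+
      fix i assume i: "i < m"
      show "Ck_on m k S (\<lambda>x. \<Sum>j<n. partial_deriv j f (g x) * partial_deriv i (\<lambda>x. g x j) x)"
      proof (intro Ck_on_sum[OF S] Ck_on_mult[OF S])
        fix j assume "j \<in> {..<n}"
        then have j: "j < n" by simp
        show "Ck_on m k S (\<lambda>x. partial_deriv j f (g x))"
          by (rule Suc.IH[OF Ck_on_SucD_lower[OF Suc.prems(1)] Ck_on_SucD(1)[OF Suc.prems(2) j]])
        show "Ck_on m k S (partial_deriv i (\<lambda>x. g x j))"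
          using Ck_on_SucD(1)[OF Suc.prems(1)[OF j] i] .
      qed
      fix x assume x: "x \<in> S"
      have "((\<lambda>t. f (g (x(i := t)))) has_real_derivative
          (\<Sum>j<n. partial_deriv j f (g (x(i := x i))) * partial_deriv i (\<lambda>x. g x j) x)) (at (x i))"
      proof (rule has_real_derivative_compose_C1[OF T])
        show "((\<lambda>t. f (y(j := t))) has_real_derivative partial_deriv j f y) (at (y j))"
          if "j < n" "y \<in> T" for j y
          using Ck_on_SucD(2)[OF Suc.prems(2) that] .
        show "continuous_map (subtopology (Euclidean_space n) T) euclideanreal (partial_deriv j f)"
          if "j < n" for j
          using Ck_on_imp_continuous[OF Ck_on_SucD(1)[OF Suc.prems(2) that]] .
        show "g (x(i := x i)) \<in> T" using ST x by simp
        show "\<forall>\<^sub>F t in nhds (x i). g (x(i := t)) \<in> topspace (Euclidean_space n)"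
          using eventually_line_in_openin[OF S x i] by eventually_elim (use ST T_top in blast)
        show "((\<lambda>t. g (x(i := t)) j) has_real_derivative partial_deriv i (\<lambda>x. g x j) x) (at (x i))"
          if "j < n" for j
          using Ck_on_SucD(2)[OF Suc.prems(1)[OF that] i x] .
      qed
      then show "((\<lambda>t. f (g (x(i := t)))) has_real_derivative
          (\<Sum>j<n. partial_deriv j f (g x) * partial_deriv i (\<lambda>x. g x j) x)) (at (x i))"
        by simp
    qed
  }
qed

section \<open>A flat function on the real line\<close>

text \<open>
  Induction on \<open>p\<close> peels off the lowest coefficient and multiplies the rest by \<open>x\<close>, hence the additional
  factor \<open>x ^ k\<close>.
\<close>

lemma tendsto_power_poly_div_exp_0:
  fixes p :: "real poly"
  shows "((\<lambda>x. x ^ k * poly p x / exp x) \<longlongrightarrow> 0) at_top"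
proof (induction p arbitrary: k)
  case (pCons a p)
  have "((\<lambda>x. a * (x ^ k / exp x) + x ^ Suc k * poly p x / exp x) \<longlongrightarrow> a * 0 + 0) at_top"
    by (intro tendsto_add tendsto_mult tendsto_const tendsto_power_div_exp_0 pCons.IH)
  then show ?case
    by (simp add: algebra_simps add_divide_distrib)
qed simp

text \<open>
  The derivatives of \<open>exp (-1/t)\<close> are polynomials in \<open>1/t\<close> times \<open>exp (-1/t)\<close>.  Extended by zero to
  \<open>t \<le> 0\<close>, all functions of this form together are a class closed under differentiation.
\<close>

definition flat_fun :: "real poly \<Rightarrow> real \<Rightarrow> real" where
  "flat_fun p t = (if t > 0 then poly p (inverse t) * exp (- inverse t) else 0)"

text \<open>
  For positive \<open>t\<close> this is the product rule: with \<open>X = 1/t\<close>, whose derivative is \<open>-X\<^sup>2\<close>, the derivative of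
  \<open>p(X) exp(-X)\<close> is \<open>X\<^sup>2 (p(X) - p'(X)) exp(-X)\<close>.  At \<open>t = 0\<close> the exponential beats any power of \<open>1/t\<close>.
\<close>

lemma DERIV_flat_fun:
  "(flat_fun p has_real_derivative flat_fun ([:0, 0, 1:] * (p - pderiv p)) t) (at t)"
proof -
  consider "t > 0" | "t < 0" | "t = 0" by linarith
  then show ?thesis
  proof cases
    case 1
    have "((\<lambda>t. poly p (inverse t) * exp (- inverse t)) has_real_derivative
        poly ([:0, 0, 1:] * (p - pderiv p)) (inverse t) * exp (- inverse t)) (at t)"
      using 1 by (auto intro!: derivative_eq_intros simp: algebra_simps power2_eq_square)
    moreover have "\<forall>\<^sub>F s in nhds t. flat_fun p s = poly p (inverse s) * exp (- inverse s)"
      using eventually_nhds_in_open[of "{0<..}" t] 1 by (auto elim!: eventually_mono simp: flat_fun_def)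
    ultimately show ?thesis
      using 1 by (subst DERIV_cong_ev[OF refl _ refl]) (auto simp: flat_fun_def)
  next
    case 2
    have "\<forall>\<^sub>F s in nhds t. flat_fun p s = 0"
      using eventually_nhds_in_open[of "{..<0}" t] 2 by (auto elim!: eventually_mono simp: flat_fun_def)
    then show ?thesis
      using 2 by (subst DERIV_cong_ev[OF refl _ refl]) (auto simp: flat_fun_def)
  next
    case 3
    have "((\<lambda>h. flat_fun p h / h) \<longlongrightarrow> 0) (at_left 0)"
      by (rule tendsto_eventually)
         (auto simp: eventually_at_filter flat_fun_def)
    moreover have "((\<lambda>h. flat_fun p h / h) \<longlongrightarrow> 0) (at_right 0)"
      unfolding filterlim_at_right_to_top
    proof (rule Lim_transform_eventually)
      show "((\<lambda>x::real. x ^ 1 * poly p x / exp x) \<longlongrightarrow> 0) at_top"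
        by (rule tendsto_power_poly_div_exp_0)
      show "\<forall>\<^sub>F x in at_top. x ^ 1 * poly p x / exp x = flat_fun p (inverse x) / inverse x"
        using eventually_gt_at_top[of 0]
        by eventually_elim (simp add: flat_fun_def exp_minus field_simps)
    qed
    ultimately have "((\<lambda>h. flat_fun p h / h) \<longlongrightarrow> 0) (at 0)"
      by (simp add: filterlim_split_at)
    then show ?thesis
      using 3 by (simp add: has_field_derivative_iff flat_fun_def)
  qed
qed

definition flat_exp :: "real \<Rightarrow> real" where
  "flat_exp t = (if t > 0 then exp (- inverse t) else 0)"

lemma flat_exp_pos_iff [simp]: "flat_exp t > 0 \<longleftrightarrow> t > 0"
  by (simp add: flat_exp_def)

lemma flat_exp_nonneg [simp]: "flat_exp t \<ge> 0"
  by (simp add: flat_exp_def)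

lemma flat_exp_eq_0 [simp]: "t \<le> 0 \<Longrightarrow> flat_exp t = 0"
  by (simp add: flat_exp_def)

lemma flat_exp_mono: "s \<le> t \<Longrightarrow> flat_exp s \<le> flat_exp t"
  by (auto simp: flat_exp_def)

lemma Ck_on_flat_exp:
  assumes S: "openin (Euclidean_space n) S" and "Ck_on n k S f"
  shows "Ck_on n k S (\<lambda>x. flat_exp (f x))"
proof (rule Ck_on_compose_real[OF S, where F = "range flat_fun" and A = UNIV and s = flat_exp and f = f])
  show "flat_exp \<in> range flat_fun"
    by (rule range_eqI[of _ _ 1]) (auto simp: flat_fun_def flat_exp_def)
qed (use assms DERIV_flat_fun in auto)

section \<open>Smooth functions on open subsets of Euclidean space\<close>

lemma smooth_on_cong:
  "openin (Euclidean_space n) S \<Longrightarrow> (\<And>y. y \<in> S \<Longrightarrow> f y = g y) \<Longrightarrow> smooth_on n S f \<longleftrightarrow> smooth_on n S g"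
  unfolding smooth_on_def by (intro all_cong1 Ck_on_cong)

lemma smooth_on_mono: "smooth_on n S f \<Longrightarrow> T \<subseteq> S \<Longrightarrow> smooth_on n T f"
  unfolding smooth_on_def by (auto intro: Ck_on_mono)

lemma smooth_on_local:
  assumes "openin (Euclidean_space n) S"
    and "\<And>x. x \<in> S \<Longrightarrow> \<exists>T. openin (Euclidean_space n) T \<and> x \<in> T \<and> T \<subseteq> S \<and> smooth_on n T f"
  shows "smooth_on n S f"
  unfolding smooth_on_def
proof
  fix k
  show "Ck_on n k S f"
  proof (rule Ck_on_local[OF assms(1)])
    fix x assume "x \<in> S"
    from assms(2)[OF this] show "\<exists>T. openin (Euclidean_space n) T \<and> x \<in> T \<and> T \<subseteq> S \<and> Ck_on n k T f"
      by (auto simp: smooth_on_def)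
  qed
qed

lemma smooth_on_const: "smooth_on n S (\<lambda>x. c)"
  by (simp add: smooth_on_def Ck_on_const)

lemma smooth_on_coord: "j < n \<Longrightarrow> smooth_on n S (\<lambda>x. x j)"
  by (simp add: smooth_on_def Ck_on_coord)

lemma smooth_on_add:
  "openin (Euclidean_space n) S \<Longrightarrow> smooth_on n S f \<Longrightarrow> smooth_on n S g \<Longrightarrow> smooth_on n S (\<lambda>x. f x + g x)"
  by (simp add: smooth_on_def Ck_on_add)

lemma smooth_on_mult:
  "openin (Euclidean_space n) S \<Longrightarrow> smooth_on n S f \<Longrightarrow> smooth_on n S g \<Longrightarrow> smooth_on n S (\<lambda>x. f x * g x)"
  by (simp add: smooth_on_def Ck_on_mult)

lemma smooth_on_diff:
  assumes "openin (Euclidean_space n) S" "smooth_on n S f" "smooth_on n S g"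
  shows "smooth_on n S (\<lambda>x. f x - g x)"
  using smooth_on_add[OF assms(1,2) smooth_on_mult[OF assms(1) smooth_on_const[of n S "-1"] assms(3)]]
  by simp

lemma smooth_on_prod:
  "openin (Euclidean_space n) S \<Longrightarrow> (\<And>j. j \<in> J \<Longrightarrow> smooth_on n S (f j)) \<Longrightarrow> smooth_on n S (\<lambda>x. \<Prod>j\<in>J. f j x)"
  unfolding smooth_on_def by (intro allI Ck_on_prod) simp_all

lemma smooth_on_inverse:
  "openin (Euclidean_space n) S \<Longrightarrow> smooth_on n S f \<Longrightarrow> (\<And>x. x \<in> S \<Longrightarrow> f x \<noteq> 0) \<Longrightarrow>
    smooth_on n S (\<lambda>x. inverse (f x))"
  unfolding smooth_on_def by (intro allI Ck_on_inverse) simp_all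

lemma smooth_on_flat_exp:
  "openin (Euclidean_space n) S \<Longrightarrow> smooth_on n S f \<Longrightarrow> smooth_on n S (\<lambda>x. flat_exp (f x))"
  by (simp add: smooth_on_def Ck_on_flat_exp)

lemma smooth_on_compose:
  assumes "openin (Euclidean_space m) S" "openin (Euclidean_space n) T"
    and "\<And>x. x \<in> S \<Longrightarrow> g x \<in> T" "smooth_vec_on m n S g" "smooth_on n T f"
  shows "smooth_on m S (\<lambda>x. f (g x))"
  unfolding smooth_on_def
proof
  fix k
  show "Ck_on m k S (\<lambda>x. f (g x))"
    by (rule Ck_on_compose[OF assms(1,2)]) (use assms(3-) in \<open>simp_all add: smooth_on_def smooth_vec_on_def\<close>)
qed

section \<open>Smooth functions on a manifold\<close>

locale smooth_mfd =
  fixes M :: "'a manifold"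
  assumes smooth_manifold: "smooth_manifold M"
begin

lemma is_chartI: "(U, u) \<in> matlas M \<Longrightarrow> is_chart (mtopology M) (mdim M) (U, u)"
  using smooth_manifold unfolding smooth_manifold_def by blast

lemma chart_open: "(U, u) \<in> matlas M \<Longrightarrow> openin (mtopology M) U"
  using is_chartI unfolding is_chart_def by auto

lemma chart_subset: "(U, u) \<in> matlas M \<Longrightarrow> U \<subseteq> points M"
  using chart_open openin_subset by blast

lemma chart_homeomorphic:
  "(U, u) \<in> matlas M \<Longrightarrow>
    homeomorphic_map (subtopology (mtopology M) U) (subtopology (Euclidean_space (mdim M)) (u ` U)) u"
  using is_chartI unfolding is_chart_def by auto

lemma chart_inj: "(U, u) \<in> matlas M \<Longrightarrow> inj_on u U"
  using homeomorphic_imp_injective_map[OF chart_homeomorphic] chart_subset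
  by (simp add: Int_absorb1)

lemma chart_inv [simp]: "(U, u) \<in> matlas M \<Longrightarrow> x \<in> U \<Longrightarrow> inv_into U u (u x) = x"
  by (simp add: chart_inj)

lemma chart_image_open:
  assumes "(U, u) \<in> matlas M" "openin (mtopology M) W" "W \<subseteq> U"
  shows "openin (Euclidean_space (mdim M)) (u ` W)"
proof -
  have U: "openin (Euclidean_space (mdim M)) (u ` U)"
    using is_chartI[OF assms(1)] unfolding is_chart_def by auto
  have "openin (subtopology (mtopology M) U) W"
    using assms chart_open openin_open_subtopology by blast
  then have "openin (subtopology (Euclidean_space (mdim M)) (u ` U)) (u ` W)"
    using homeomorphic_map_openness[OF chart_homeomorphic[OF assms(1)]] openin_subset by blast
  then show ?thesis
    using U openin_trans_full by blast
qed

lemma chart_at: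
  assumes "p \<in> points M"
  obtains U u where "(U, u) \<in> matlas M" "p \<in> U"
  using assms smooth_manifold unfolding smooth_manifold_def by fastforce

lemma transition_smooth:
  assumes "(U, u) \<in> matlas M" "(V, v) \<in> matlas M"
  shows "smooth_vec_on (mdim M) (mdim M) (v ` (U \<inter> V)) (u \<circ> inv_into V v)"
  using assms smooth_manifold unfolding smooth_manifold_def smoothly_compatible_def by fastforce

text \<open>
  Compatibility of the charts and the chain rule: smoothness on an open set may be tested in any chart.
\<close>

lemma smooth_on_change_chart:
  assumes U: "(U, u) \<in> matlas M" and V: "(V, v) \<in> matlas M"
    and W: "openin (mtopology M) W" "W \<subseteq> U"
    and f: "smooth_on (mdim M) (u ` W) (\<lambda>y. f (inv_into U u y))"
  shows "smooth_on (mdim M) (v ` (W \<inter> V)) (\<lambda>y. f (inv_into V v y))"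
proof -
  have o: "openin (Euclidean_space (mdim M)) (v ` (W \<inter> V))"
    using W(1) chart_open[OF V] by (intro chart_image_open[OF V] openin_Int) auto
  have "smooth_vec_on (mdim M) (mdim M) (v ` (W \<inter> V)) (u \<circ> inv_into V v)"
    using transition_smooth[OF U V] W(2) smooth_on_mono[of _ "v ` (U \<inter> V)" _ "v ` (W \<inter> V)"]
    unfolding smooth_vec_on_def by blast
  then have "smooth_on (mdim M) (v ` (W \<inter> V)) (\<lambda>y. f (inv_into U u ((u \<circ> inv_into V v) y)))"
    by (rule smooth_on_compose[OF o chart_image_open[OF U W], rotated]) (use f V in auto)
  then show ?thesis
    by (subst smooth_on_cong[OF o, of _ "\<lambda>y. f (inv_into U u ((u \<circ> inv_into V v) y))"])
       (use U V W(2) in auto)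
qed

lemma smooth_functionsD:
  assumes "f \<in> smooth_functions M" "(U, u) \<in> matlas M" "W \<subseteq> U"
  shows "smooth_on (mdim M) (u ` W) (\<lambda>y. f (inv_into U u y))"
proof -
  have "smooth_on (mdim M) (u ` U) (f \<circ> inv_into U u)"
    using assms unfolding smooth_functions_def by blast
  then show ?thesis
    using smooth_on_mono[of _ "u ` U" _ "u ` W"] assms(3) by (auto simp: o_def)
qed

text \<open>
  Each point may be given a chart of its own choice, and then \<open>smooth_on_change_chart\<close> covers all other
  charts.
\<close>

lemma smooth_functions_localI:
  assumes "\<And>p. p \<in> points M \<Longrightarrow> \<exists>U u W. (U, u) \<in> matlas M \<and> openin (mtopology M) W \<and> p \<in> W \<and> W \<subseteq> U \<and>
      smooth_on (mdim M) (u ` W) (\<lambda>y. f (inv_into U u y))"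
  shows "restrict f (points M) \<in> smooth_functions M"
proof -
  have "smooth_on (mdim M) (v ` V) (restrict f (points M) \<circ> inv_into V v)" if V: "(V, v) \<in> matlas M" for V v
  proof -
    have o: "openin (Euclidean_space (mdim M)) (v ` V)"
      by (rule chart_image_open[OF V chart_open[OF V]]) simp
    have "smooth_on (mdim M) (v ` V) (\<lambda>y. f (inv_into V v y))"
    proof (rule smooth_on_local[OF o])
      fix y assume "y \<in> v ` V"
      then obtain p where p: "p \<in> V" "y = v p" by auto
      then have "p \<in> points M" using chart_subset[OF V] by auto
      then obtain U u W where U: "(U, u) \<in> matlas M" and W: "openin (mtopology M) W" "p \<in> W" "W \<subseteq> U"
        and s: "smooth_on (mdim M) (u ` W) (\<lambda>y. f (inv_into U u y))"
        using assms by blast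
      have "openin (Euclidean_space (mdim M)) (v ` (W \<inter> V))"
        using W(1) chart_open[OF V] by (intro chart_image_open[OF V] openin_Int) auto
      then show "\<exists>T. openin (Euclidean_space (mdim M)) T \<and> y \<in> T \<and> T \<subseteq> v ` V \<and>
          smooth_on (mdim M) T (\<lambda>y. f (inv_into V v y))"
        using smooth_on_change_chart[OF U V W(1,3) s] p W(2) by blast
    qed
    then show ?thesis
      by (subst smooth_on_cong[OF o, of _ "\<lambda>y. f (inv_into V v y)"]) (use V chart_subset[OF V] in auto)
  qed
  then show ?thesis
    unfolding smooth_functions_def by auto
qed

lemma smooth_functionsI:
  assumes "\<And>U u. (U, u) \<in> matlas M \<Longrightarrow> openin (Euclidean_space (mdim M)) (u ` U) \<Longrightarrow>
      smooth_on (mdim M) (u ` U) (\<lambda>y. f (inv_into U u y))"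
  shows "restrict f (points M) \<in> smooth_functions M"
proof (rule smooth_functions_localI)
  fix p assume "p \<in> points M"
  then obtain U u where U: "(U, u) \<in> matlas M" "p \<in> U" by (rule chart_at)
  moreover have "openin (Euclidean_space (mdim M)) (u ` U)"
    by (rule chart_image_open[OF U(1) chart_open[OF U(1)]]) simp
  ultimately show "\<exists>U u W. (U, u) \<in> matlas M \<and> openin (mtopology M) W \<and> p \<in> W \<and> W \<subseteq> U \<and>
      smooth_on (mdim M) (u ` W) (\<lambda>y. f (inv_into U u y))"
    using assms chart_open by blast
qed

lemma smooth_functions_glue:
  assumes "\<And>p. p \<in> points M \<Longrightarrow> \<exists>W g. openin (mtopology M) W \<and> p \<in> W \<and> g \<in> smooth_functions M \<and>
      (\<forall>x\<in>W. f x = g x)"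
  shows "restrict f (points M) \<in> smooth_functions M"
proof (rule smooth_functions_localI)
  fix p assume p: "p \<in> points M"
  then obtain W g where W: "openin (mtopology M) W" "p \<in> W" "g \<in> smooth_functions M" "\<forall>x\<in>W. f x = g x"
    using assms by blast
  obtain U u where U: "(U, u) \<in> matlas M" "p \<in> U" using p by (rule chart_at)
  have UW: "openin (mtopology M) (U \<inter> W)"
    using W(1) chart_open[OF U(1)] by auto
  then have "smooth_on (mdim M) (u ` (U \<inter> W)) (\<lambda>y. f (inv_into U u y))"
    by (subst smooth_on_cong[OF chart_image_open[OF U(1)], of _ _ "\<lambda>y. g (inv_into U u y)"])
       (use W U smooth_functionsD[OF W(3) U(1), of "U \<inter> W"] in auto)
  then show "\<exists>U u W. (U, u) \<in> matlas M \<and> openin (mtopology M) W \<and> p \<in> W \<and> W \<subseteq> U \<and>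
      smooth_on (mdim M) (u ` W) (\<lambda>y. f (inv_into U u y))"
    using U W UW by blast
qed

lemma smooth_functions_const: "(\<lambda>x\<in>points M. c) \<in> smooth_functions M"
  by (rule smooth_functionsI) (rule smooth_on_const)

lemma smooth_functions_add:
  assumes "f \<in> smooth_functions M" "g \<in> smooth_functions M"
  shows "(\<lambda>x\<in>points M. f x + g x) \<in> smooth_functions M"
  by (rule smooth_functionsI, rule smooth_on_add) (use assms smooth_functionsD in auto)

lemma smooth_functions_mult:
  assumes "f \<in> smooth_functions M" "g \<in> smooth_functions M"
  shows "(\<lambda>x\<in>points M. f x * g x) \<in> smooth_functions M"
  by (rule smooth_functionsI, rule smooth_on_mult) (use assms smooth_functionsD in auto)

lemma smooth_functions_inverse:
  assumes "f \<in> smooth_functions M" "\<And>x. x \<in> points M \<Longrightarrow> f x \<noteq> 0"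
  shows "(\<lambda>x\<in>points M. inverse (f x)) \<in> smooth_functions M"
proof (rule smooth_functionsI, rule smooth_on_inverse)
  fix U u y assume "(U, u) \<in> matlas M" "y \<in> u ` U"
  then have "inv_into U u y \<in> points M"
    using chart_subset inv_into_into[of y u U] by blast
  then show "f (inv_into U u y) \<noteq> 0"
    by (rule assms(2))
qed (use assms(1) smooth_functionsD in auto)

lemma smooth_functions_sum:
  assumes "finite J" "\<And>j. j \<in> J \<Longrightarrow> f j \<in> smooth_functions M"
  shows "(\<lambda>x\<in>points M. \<Sum>j\<in>J. f j x) \<in> smooth_functions M"
  using assms
proof (induction J)
  case (insert j J)
  have "(\<lambda>x\<in>points M. f j x + (\<lambda>x\<in>points M. \<Sum>j\<in>J. f j x) x) =
      (\<lambda>x\<in>points M. \<Sum>j\<in>insert j J. f j x)"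
    using insert by (auto simp: restrict_def)
  moreover have "(\<lambda>x\<in>points M. f j x + (\<lambda>x\<in>points M. \<Sum>j\<in>J. f j x) x) \<in> smooth_functions M"
    using insert by (intro smooth_functions_add) auto
  ultimately show ?case
    by (simp only:)
qed (use smooth_functions_const[of 0] in simp)

lemma smooth_functions_prod:
  assumes "finite J" "\<And>j. j \<in> J \<Longrightarrow> f j \<in> smooth_functions M"
  shows "(\<lambda>x\<in>points M. \<Prod>j\<in>J. f j x) \<in> smooth_functions M"
  using assms
proof (induction J)
  case (insert j J)
  have "(\<lambda>x\<in>points M. f j x * (\<lambda>x\<in>points M. \<Prod>j\<in>J. f j x) x) =
      (\<lambda>x\<in>points M. \<Prod>j\<in>insert j J. f j x)"
    using insert by (auto simp: restrict_def)
  moreover have "(\<lambda>x\<in>points M. f j x * (\<lambda>x\<in>points M. \<Prod>j\<in>J. f j x) x) \<in> smooth_functions M"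
    using insert by (intro smooth_functions_mult) auto
  ultimately show ?case
    by (simp only:)
qed (use smooth_functions_const[of 1] in simp)

lemma smooth_functions_continuous:
  assumes "f \<in> smooth_functions M"
  shows "continuous_map (mtopology M) euclideanreal f"
proof -
  have "continuous_map (subtopology (mtopology M) (points M)) euclideanreal f"
  proof (rule continuous_map_locally_openin)
    fix p assume "p \<in> points M"
    then obtain U u where U: "(U, u) \<in> matlas M" "p \<in> U" by (rule chart_at)
    have "continuous_map (subtopology (mtopology M) U) (subtopology (Euclidean_space (mdim M)) (u ` U)) u"
      using homeomorphic_imp_continuous_map[OF chart_homeomorphic[OF U(1)]] .
    moreover have "continuous_map (subtopology (Euclidean_space (mdim M)) (u ` U)) euclideanreal
        (\<lambda>y. f (inv_into U u y))"
      using smooth_functionsD[OF assms U(1) order_refl] Ck_on_imp_continuous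
      unfolding smooth_on_def by blast
    ultimately have "continuous_map (subtopology (mtopology M) U) euclideanreal
        ((\<lambda>y. f (inv_into U u y)) \<circ> u)"
      by (rule continuous_map_compose)
    then have "continuous_map (subtopology (mtopology M) U) euclideanreal f"
      by (rule continuous_map_eq) (use U in auto)
    then show "\<exists>T. openin (mtopology M) T \<and> p \<in> T \<and> T \<subseteq> points M \<and>
        continuous_map (subtopology (mtopology M) T) euclideanreal f"
      using U(2) chart_open[OF U(1)] chart_subset[OF U(1)] by (intro exI[of _ U] conjI)
  qed simp
  then show ?thesis by simp
qed

lemma openin_smooth_functions_greater:
  assumes "f \<in> smooth_functions M"
  shows "openin (mtopology M) {x \<in> points M. f x > c}"
  using openin_continuous_map_preimage[OF smooth_functions_continuous[OF assms], of "{c<..}"] by simp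

subsection \<open>Bump functions\<close>

text \<open>
  In the coordinates \<open>v\<close> the function \<open>b\<close> is a product of flat functions, positive exactly on an open box
  around \<open>v p\<close> whose closure lies in \<open>v ` (V \<inter> W)\<close>.  The closed box is compact, hence so is its preimage
  \<open>K\<close> in \<open>M\<close>, which is closed because \<open>M\<close> is Hausdorff.  So \<open>V\<close> and the complement of \<open>K\<close> are two open
  sets covering \<open>M\<close>, on each of which \<open>b * h\<close> is visibly smooth.  The factor \<open>h\<close>, smooth on \<open>V\<close> only, is
  needed to extend the coordinates of a chart, multiplied by \<open>b\<close>, to the whole manifold.
\<close>

lemma bump_function:
  assumes V: "(V, v) \<in> matlas M" and W: "openin (mtopology M) W" and p: "p \<in> V" "p \<in> W"
  obtains b where "b p > 0" "\<And>x. x \<notin> V \<inter> W \<Longrightarrow> b x = 0"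
    "\<And>h. smooth_on (mdim M) (v ` V) (\<lambda>y. h (inv_into V v y)) \<Longrightarrow>
      (\<lambda>x\<in>points M. b x * h x) \<in> smooth_functions M"
proof -
  define n where "n = mdim M"
  define a where "a = v p"
  have VW: "openin (Euclidean_space n) (v ` (V \<inter> W))"
    unfolding n_def using W chart_open[OF V] by (intro chart_image_open[OF V] openin_Int) auto
  have oV: "openin (Euclidean_space n) (v ` V)"
    unfolding n_def by (rule chart_image_open[OF V chart_open[OF V]]) simp
  have "a \<in> v ` (V \<inter> W)" using p by (auto simp: a_def)
  then obtain \<delta> where \<delta>: "\<delta> > 0"
    "\<And>y. y \<in> topspace (Euclidean_space n) \<Longrightarrow> (\<And>i. i < n \<Longrightarrow> \<bar>y i - a i\<bar> < \<delta>) \<Longrightarrow> y \<in> v ` (V \<inter> W)"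
    using openin_Euclidean_space_imp_box[OF VW] by metis
  define r where "r = \<delta> / 2"
  have r: "r > 0" using \<delta> by (simp add: r_def)
  define B where "B = (\<Pi>\<^sub>E i\<in>UNIV. if i < n then {a i - r..a i + r} else {0})"
  have B_iff: "y \<in> B \<longleftrightarrow> y \<in> topspace (Euclidean_space n) \<and> (\<forall>i<n. \<bar>y i - a i\<bar> \<le> r)" for y
  proof -
    have "y \<in> B \<longleftrightarrow> (\<forall>i. y i \<in> (if i < n then {a i - r..a i + r} else {0}))"
      by (simp add: B_def PiE_UNIV_domain Pi_iff)
    also have "\<dots> \<longleftrightarrow> (\<forall>i\<ge>n. y i = 0) \<and> (\<forall>i<n. y i \<in> {a i - r..a i + r})"
      by (metis (mono_tags, lifting) leD leI singletonD singletonI)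
    also have "\<dots> \<longleftrightarrow> y \<in> topspace (Euclidean_space n) \<and> (\<forall>i<n. \<bar>y i - a i\<bar> \<le> r)"
      by (simp add: topspace_Euclidean_space abs_le_iff algebra_simps conj_commute)
    finally show ?thesis .
  qed
  have B_sub: "B \<subseteq> v ` (V \<inter> W)"
  proof
    fix y assume "y \<in> B"
    moreover have "\<bar>y i - a i\<bar> < \<delta>" if "\<bar>y i - a i\<bar> \<le> r" for i
      using that \<delta>(1) by (simp add: r_def)
    ultimately show "y \<in> v ` (V \<inter> W)"
      unfolding B_iff by (intro \<delta>(2)) auto
  qed
  have "compactin (powertop_real UNIV) B"
    unfolding B_def compactin_PiE by auto
  then have "compactin (Euclidean_space n) B"
    unfolding Euclidean_space_def compactin_subtopology by (auto simp: B_iff topspace_Euclidean_space)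
  then have cB: "compactin (subtopology (Euclidean_space n) (v ` V)) B"
    using B_sub by (auto simp: compactin_subtopology)
  obtain g where g: "homeomorphic_maps (subtopology (mtopology M) V) (subtopology (Euclidean_space n) (v ` V)) v g"
    using chart_homeomorphic[OF V] by (auto simp: homeomorphic_map_maps n_def)
  then have gv: "g (v x) = x" if "x \<in> V" for x
    using that chart_subset[OF V] by (auto simp: homeomorphic_maps_def)
  define K where "K = g ` B"
  have "continuous_map (subtopology (Euclidean_space n) (v ` V)) (subtopology (mtopology M) V) g"
    using g by (simp add: homeomorphic_maps_def)
  then have "compactin (subtopology (mtopology M) V) K"
    unfolding K_def using cB image_compactin by blast
  then have "compactin (mtopology M) K"
    by (simp add: compactin_subtopology)
  moreover have "Hausdorff_space (mtopology M)"
    using smooth_manifold by (simp add: smooth_manifold_def)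
  ultimately have K_closed: "closedin (mtopology M) K"
    by (simp add: compactin_imp_closedin)
  have K_sub: "K \<subseteq> V \<inter> W"
    using B_sub gv by (fastforce simp: K_def)
  define \<beta> where "\<beta> y = (\<Prod>i<n. flat_exp (r\<^sup>2 - (y i - a i)\<^sup>2))" for y
  define b where "b x = (if x \<in> V then \<beta> (v x) else 0)" for x
  have b_0: "b x = 0" if "x \<notin> K" for x
  proof (cases "x \<in> V")
    case True
    then have "v x \<notin> B"
      using that gv[OF True] by (force simp: K_def)
    moreover have "v x \<in> topspace (Euclidean_space n)"
      using openin_subset[OF oV] True by auto
    ultimately obtain i where i: "i < n" "r < \<bar>v x i - a i\<bar>"
      by (auto simp: B_iff not_le)
    then have "r\<^sup>2 \<le> (v x i - a i)\<^sup>2"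
      using r by (metis less_imp_le power2_abs power_mono)
    then have "flat_exp (r\<^sup>2 - (v x i - a i)\<^sup>2) = 0"
      by simp
    then show ?thesis
      using i True by (auto simp: b_def \<beta>_def)
  qed (simp add: b_def)
  show thesis
  proof (rule that[of b])
    show "b p > 0"
      using p r by (auto simp: b_def \<beta>_def a_def intro!: prod_pos)
    show "b x = 0" if "x \<notin> V \<inter> W" for x
      using b_0 K_sub that by blast
    fix h assume h: "smooth_on (mdim M) (v ` V) (\<lambda>y. h (inv_into V v y))"
    show "(\<lambda>x\<in>points M. b x * h x) \<in> smooth_functions M"
    proof (rule smooth_functions_localI)
      fix q assume q: "q \<in> points M"
      show "\<exists>U u W. (U, u) \<in> matlas M \<and> openin (mtopology M) W \<and> q \<in> W \<and> W \<subseteq> U \<and>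
          smooth_on (mdim M) (u ` W) (\<lambda>y. b (inv_into U u y) * h (inv_into U u y))"
      proof (cases "q \<in> V")
        case True
        have "smooth_on n (v ` V) \<beta>"
          unfolding \<beta>_def power2_eq_square
          by (intro smooth_on_prod smooth_on_flat_exp smooth_on_diff smooth_on_mult smooth_on_const smooth_on_coord oV)
             auto
        then have "smooth_on n (v ` V) (\<lambda>y. b (inv_into V v y))"
          by (subst smooth_on_cong[OF oV, of _ \<beta>]) (auto simp: b_def V)
        then have "smooth_on (mdim M) (v ` V) (\<lambda>y. b (inv_into V v y) * h (inv_into V v y))"
          using smooth_on_mult[OF oV] h by (simp add: n_def)
        then show ?thesis
          using V chart_open[OF V] True by blast
      next
        case False
        obtain U u where U: "(U, u) \<in> matlas M" "q \<in> U" using q by (rule chart_at)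
        have o: "openin (mtopology M) (U - K)"
          using chart_open[OF U(1)] K_closed by blast
        have "smooth_on (mdim M) (u ` (U - K)) (\<lambda>y. b (inv_into U u y) * h (inv_into U u y))"
          by (subst smooth_on_cong[OF chart_image_open[OF U(1) o], of _ "\<lambda>y. 0"])
             (auto simp: b_0 U smooth_on_const)
        then show ?thesis
          using U o False K_sub by blast
      qed
    qed
  qed
qed

lemma bump_at:
  assumes W: "openin (mtopology M) W" and p: "p \<in> W"
  obtains b where "b \<in> smooth_functions M" "b p > 0" "\<And>x. x \<in> points M - W \<Longrightarrow> b x = 0"
proof -
  have "p \<in> points M" using W p openin_subset by blast
  then obtain V v where V: "(V, v) \<in> matlas M" "p \<in> V" by (rule chart_at)
  obtain b where b: "b p > 0" "\<And>x. x \<notin> V \<inter> W \<Longrightarrow> b x = 0"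
    "\<And>h. smooth_on (mdim M) (v ` V) (\<lambda>y. h (inv_into V v y)) \<Longrightarrow>
      (\<lambda>x\<in>points M. b x * h x) \<in> smooth_functions M"
    using bump_function[OF V(1) W V(2) p] by blast
  have "(\<lambda>x\<in>points M. b x * 1) \<in> smooth_functions M"
    by (rule b(3)) (rule smooth_on_const)
  then show thesis
    using that[of "\<lambda>x\<in>points M. b x * 1"] b \<open>p \<in> points M\<close> by auto
qed

end

section \<open>Characters are evaluations\<close>

locale smooth_mfd_character = smooth_mfd +
  fixes \<psi> :: "('a \<Rightarrow> real) \<Rightarrow> real"
  assumes \<psi>_add: "\<And>f g. f \<in> smooth_functions M \<Longrightarrow> g \<in> smooth_functions M \<Longrightarrow>
      \<psi> (\<lambda>x\<in>points M. f x + g x) = \<psi> f + \<psi> g"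
    and \<psi>_mult: "\<And>f g. f \<in> smooth_functions M \<Longrightarrow> g \<in> smooth_functions M \<Longrightarrow>
      \<psi> (\<lambda>x\<in>points M. f x * g x) = \<psi> f * \<psi> g"
    and \<psi>_one: "\<psi> (\<lambda>x\<in>points M. 1) = 1"
    and \<psi>_scale: "\<And>c f. f \<in> smooth_functions M \<Longrightarrow> \<psi> (\<lambda>x\<in>points M. c * f x) = c * \<psi> f"
begin

lemma \<psi>_const: "\<psi> (\<lambda>x\<in>points M. c) = c"
proof -
  have "(\<lambda>x\<in>points M. c) = (\<lambda>x\<in>points M. c * (\<lambda>x\<in>points M. 1) x)"
    by auto
  then have "\<psi> (\<lambda>x\<in>points M. c) = \<psi> (\<lambda>x\<in>points M. c * (\<lambda>x\<in>points M. 1) x)"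
    by (rule arg_cong)
  also have "\<dots> = c"
    using \<psi>_scale[OF smooth_functions_const[of 1], of c] \<psi>_one by (simp only: mult_1_right)
  finally show ?thesis .
qed

lemma kernel_has_zero:
  assumes f: "f \<in> smooth_functions M" and "\<psi> f = 0"
  shows "\<exists>x\<in>points M. f x = 0"
proof (rule ccontr)
  assume "\<not> ?thesis"
  then have nz: "\<And>x. x \<in> points M \<Longrightarrow> f x \<noteq> 0" by blast
  define g where "g = (\<lambda>x\<in>points M. inverse (f x))"
  have g: "g \<in> smooth_functions M"
    unfolding g_def by (rule smooth_functions_inverse[OF f nz])
  have "(\<lambda>x\<in>points M. f x * g x) = (\<lambda>x\<in>points M. 1)"
    using nz by (auto simp: g_def)
  then have "\<psi> f * \<psi> g = 1"
    using \<psi>_mult[OF f g] \<psi>_one by simp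
  then show False using assms(2) by simp
qed

text \<open>
  The square is positive wherever \<open>f\<close> differs from \<open>\<psi> f\<close>; the factor \<open>c\<close> serves to make it larger than
  1 at a given such point.
\<close>

lemma square_in_kernel:
  assumes f: "f \<in> smooth_functions M"
  shows "(\<lambda>x\<in>points M. c * (f x - \<psi> f)\<^sup>2) \<in> smooth_functions M"
    and "\<psi> (\<lambda>x\<in>points M. c * (f x - \<psi> f)\<^sup>2) = 0"
proof -
  define k where "k = (\<lambda>x\<in>points M. - \<psi> f)"
  define d where "d = (\<lambda>x\<in>points M. f x + k x)"
  define s where "s = (\<lambda>x\<in>points M. d x * d x)"
  define c' where "c' = (\<lambda>x\<in>points M. c)"
  have k: "k \<in> smooth_functions M" "\<psi> k = - \<psi> f"
    unfolding k_def by (rule smooth_functions_const, rule \<psi>_const)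
  have d: "d \<in> smooth_functions M" "\<psi> d = 0"
    unfolding d_def using smooth_functions_add[OF f k(1)] \<psi>_add[OF f k(1)] k(2) by simp_all
  have s: "s \<in> smooth_functions M" "\<psi> s = 0"
    unfolding s_def using smooth_functions_mult[OF d(1) d(1)] \<psi>_mult[OF d(1) d(1)] d(2) by simp_all
  have c': "c' \<in> smooth_functions M"
    unfolding c'_def by (rule smooth_functions_const)
  have "(\<lambda>x\<in>points M. c * (f x - \<psi> f)\<^sup>2) = (\<lambda>x\<in>points M. c' x * s x)"
    by (auto simp: c'_def s_def d_def k_def power2_eq_square)
  then show "(\<lambda>x\<in>points M. c * (f x - \<psi> f)\<^sup>2) \<in> smooth_functions M"
    and "\<psi> (\<lambda>x\<in>points M. c * (f x - \<psi> f)\<^sup>2) = 0"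
    using smooth_functions_mult[OF c' s(1)] \<psi>_mult[OF c' s(1)] s(2) by simp_all
qed

lemma sum_in_kernel:
  assumes "finite J" "\<And>j. j \<in> J \<Longrightarrow> f j \<in> smooth_functions M" "\<And>j. j \<in> J \<Longrightarrow> \<psi> (f j) = 0"
  shows "\<psi> (\<lambda>x\<in>points M. \<Sum>j\<in>J. f j x) = 0"
  using assms
proof (induction J)
  case empty
  show ?case using \<psi>_const[of 0] by (simp only: sum.empty)
next
  case (insert j J)
  have IH: "\<psi> (\<lambda>x\<in>points M. \<Sum>j\<in>J. f j x) = 0"
    by (rule insert.IH) (use insert.prems in auto)
  have "(\<lambda>x\<in>points M. \<Sum>j\<in>insert j J. f j x) = (\<lambda>x\<in>points M. f j x + (\<lambda>x\<in>points M. \<Sum>j\<in>J. f j x) x)"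
    using insert by (auto simp: restrict_def)
  then have "\<psi> (\<lambda>x\<in>points M. \<Sum>j\<in>insert j J. f j x) =
      \<psi> (\<lambda>x\<in>points M. f j x + (\<lambda>x\<in>points M. \<Sum>j\<in>J. f j x) x)"
    by (rule arg_cong)
  also have "\<dots> = \<psi> (f j) + \<psi> (\<lambda>x\<in>points M. \<Sum>j\<in>J. f j x)"
    using insert by (intro \<psi>_add smooth_functions_sum) auto
  also have "\<dots> = 0"
    using insert.prems unfolding IH by simp
  finally show ?case .
qed

text \<open>
  Suppose that at every point some \<open>g i\<close> exceeds 1.  The factors \<open>e i\<close> vanish where \<open>g i\<close> exceeds 1 and
  are at least 1 where \<open>g i\<close> vanishes.  By the first property the sum \<open>h\<close> of the partial products \<open>c j\<close> is
  locally finite, hence smooth; by the second, \<open>h\<close> exceeds \<open>\<psi> h\<close> wherever sufficiently many of the \<open>g i\<close>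
  vanish.  But \<open>h = \<psi> h\<close> together with \<open>g i = 0\<close> for finitely many \<open>i\<close> has a common solution, a zero of a
  sum of nonnegative functions in the kernel.
\<close>

lemma countable_kernel_bounded_at_some_point:
  fixes g :: "nat \<Rightarrow> 'a \<Rightarrow> real"
  assumes g: "\<And>i. g i \<in> smooth_functions M" and \<psi>_g: "\<And>i. \<psi> (g i) = 0"
    and nonneg: "\<And>i x. x \<in> points M \<Longrightarrow> g i x \<ge> 0"
  shows "\<exists>x\<in>points M. \<forall>i. g i x \<le> 1"
proof (rule ccontr)
  assume "\<not> ?thesis"
  then have cover: "\<exists>i. g i x > 1" if "x \<in> points M" for x
    using that by (auto simp: not_le)
  define a where "a = flat_exp (1/2)"
  have a: "a > 0" by (simp add: a_def)
  define e where "e i = (\<lambda>x\<in>points M. flat_exp (1 - g i x) * inverse a)" for i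
  define c where "c j = (\<lambda>x\<in>points M. \<Prod>i\<le>j. e i x)" for j
  define h where "h = (\<lambda>x\<in>points M. \<Sum>j. c j x)"
  have e: "e i \<in> smooth_functions M" for i
    unfolding e_def
    by (rule smooth_functionsI, intro smooth_on_mult smooth_on_flat_exp smooth_on_diff smooth_on_const)
       (use g smooth_functionsD in auto)
  have c: "c j \<in> smooth_functions M" for j
    unfolding c_def by (rule smooth_functions_prod) (use e in auto)
  have c_0: "c j x = 0" if "x \<in> points M" "g i x > 1" "i \<le> j" for x i j
  proof -
    have "e i x = 0" using that by (simp add: e_def)
    then show ?thesis using that by (auto simp: c_def)
  qed
  have h_eq: "h x = (\<Sum>j<i. c j x)" if "x \<in> points M" "g i x > 1" for x i
    unfolding h_def using that c_0[OF that] by (simp, intro suminf_finite) auto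
  have h: "h \<in> smooth_functions M"
  proof -
    have "restrict h (points M) \<in> smooth_functions M"
    proof (rule smooth_functions_glue)
      fix p assume "p \<in> points M"
      then obtain i where i: "g i p > 1" using cover by blast
      have "openin (mtopology M) {x \<in> points M. g i x > 1}"
        by (rule openin_smooth_functions_greater[OF g])
      moreover have "(\<lambda>x\<in>points M. \<Sum>j<i. c j x) \<in> smooth_functions M"
        by (rule smooth_functions_sum) (use c in auto)
      ultimately show "\<exists>W g. openin (mtopology M) W \<and> p \<in> W \<and> g \<in> smooth_functions M \<and> (\<forall>x\<in>W. h x = g x)"
        using i \<open>p \<in> points M\<close> h_eq
        by (intro exI[of _ "{x \<in> points M. g i x > 1}"] exI[of _ "\<lambda>x\<in>points M. \<Sum>j<i. c j x"]) auto
    qed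
    then show ?thesis by (simp add: h_def)
  qed
  obtain j :: nat where j: "\<psi> h < real j"
    using reals_Archimedean2 by blast
  define s where "s = (\<lambda>x\<in>points M. \<Sum>i\<le>j. g i x)"
  have s: "s \<in> smooth_functions M" "\<psi> s = 0"
    unfolding s_def by (rule smooth_functions_sum, use g in auto) (rule sum_in_kernel, use g \<psi>_g in auto)
  \<comment> \<open>The factor 1 brings the square into the form of \<open>square_in_kernel\<close>.\<close>
  define q where "q = (\<lambda>x\<in>points M. 1 * (h x - \<psi> h)\<^sup>2)"
  have q: "q \<in> smooth_functions M" "\<psi> q = 0"
    unfolding q_def by (rule square_in_kernel[OF h])+
  have "\<psi> (\<lambda>x\<in>points M. s x + q x) = 0"
    using \<psi>_add[OF s(1) q(1)] s(2) q(2) by simp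
  then obtain x where x: "x \<in> points M" "s x + q x = 0"
    using kernel_has_zero[OF smooth_functions_add[OF s(1) q(1)]] by auto
  have "s x \<ge> 0" "q x \<ge> 0"
    using x(1) nonneg by (auto simp: s_def q_def intro: sum_nonneg)
  then have "s x = 0" "q x = 0"
    using x(2) by auto
  then have "h x = \<psi> h"
    using x(1) by (simp add: q_def)
  have g_0: "g i x = 0" if "i \<le> j" for i
    using \<open>s x = 0\<close> x(1) nonneg that sum_nonneg_eq_0_iff[of "{..j}" "\<lambda>i. g i x"]
    by (simp add: s_def)
  have e_ge: "e i x \<ge> 1" if "i \<le> j" for i
  proof -
    have "a \<le> flat_exp (1 - g i x)"
      unfolding a_def g_0[OF that] by (rule flat_exp_mono) simp
    then show ?thesis
      using x(1) a by (simp add: e_def field_simps)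
  qed
  have c_ge: "c i x \<ge> 1" if "i \<le> j" for i
    unfolding c_def using x(1) e_ge that by (auto intro!: prod_ge_1)
  obtain i where i: "g i x > 1" using cover[OF x(1)] by blast
  have "i > j" using i g_0[of i] by (cases "i \<le> j") auto
  have e_nonneg: "e i x \<ge> 0" for i
    using x(1) a by (simp add: e_def)
  have "real (card {..<j}) * 1 \<le> (\<Sum>k<j. c k x)"
    by (rule sum_bounded_below) (use c_ge in auto)
  also have "\<dots> \<le> (\<Sum>k<i. c k x)"
    using \<open>i > j\<close> x(1) e_nonneg by (intro sum_mono2) (auto simp: c_def intro!: prod_nonneg)
  also have "\<dots> = h x"
    using h_eq[OF x(1) i] by simp
  finally show False
    using \<open>h x = \<psi> h\<close> j by simp
qed

text \<open>
  Otherwise the open sets on which some nonnegative function in the kernel exceeds 1 would cover \<open>M\<close>, and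
  by second countability countably many of them would do so, against the preceding lemma.
\<close>

lemma character_is_evaluation: "\<exists>p\<in>points M. \<forall>f\<in>smooth_functions M. \<psi> f = f p"
proof (rule ccontr)
  assume "\<not> ?thesis"
  then have bad: "\<exists>f\<in>smooth_functions M. f p \<noteq> \<psi> f" if "p \<in> points M" for p
    using that by metis
  define G where "G = {g \<in> smooth_functions M. \<psi> g = 0 \<and> (\<forall>x\<in>points M. g x \<ge> 0)}"
  define D where "D g = {x \<in> points M. g x > (1::real)}" for g
  have "\<exists>g\<in>G. p \<in> D g" if p: "p \<in> points M" for p
  proof -
    obtain f where f: "f \<in> smooth_functions M" "f p \<noteq> \<psi> f"
      using bad[OF p] by blast
    define c where "c = 2 / (f p - \<psi> f)\<^sup>2"
    have "(\<lambda>x\<in>points M. c * (f x - \<psi> f)\<^sup>2) \<in> G"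
      using square_in_kernel[OF f(1), of c] by (auto simp: G_def c_def)
    moreover have "p \<in> D (\<lambda>x\<in>points M. c * (f x - \<psi> f)\<^sup>2)"
      using p f(2) by (simp add: D_def c_def)
    ultimately show ?thesis by blast
  qed
  then have "\<Union>(D ` G) = points M"
    by (auto simp: D_def)
  moreover have "Lindelof_space (mtopology M)"
    using smooth_manifold by (simp add: smooth_manifold_def second_countable_imp_Lindelof_space)
  moreover have "\<forall>U\<in>D ` G. openin (mtopology M) U"
    using openin_smooth_functions_greater by (auto simp: D_def G_def)
  ultimately obtain \<V> where \<V>: "countable \<V>" "\<V> \<subseteq> D ` G" "\<Union>\<V> = points M"
    unfolding Lindelof_space_def by meson
  then obtain H where "countable H" "H \<subseteq> G" "\<V> = D ` H"
    using countable_subset_image[of \<V> D G] by auto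
  with \<V>(3) have H: "countable H" "H \<subseteq> G" "\<Union>(D ` H) = points M"
    by simp_all
  \<comment> \<open>Adding the zero function makes the countable set nonempty, so that it is the range of a sequence.\<close>
  define z where "z = (\<lambda>x\<in>points M. 0::real)"
  have z: "z \<in> G"
    unfolding G_def z_def using smooth_functions_const[of 0] \<psi>_const[of 0] by auto
  define g where "g = from_nat_into (insert z H)"
  have range_g: "range g = insert z H"
    unfolding g_def using H(1) by (intro range_from_nat_into) auto
  have "g i \<in> G" for i
    using rangeI[of g i] range_g z H(2) by auto
  then obtain x where x: "x \<in> points M" "\<forall>i. g i x \<le> 1"
    using countable_kernel_bounded_at_some_point[of g] by (auto simp: G_def)
  obtain k where k: "k \<in> H" "x \<in> D k" using H(3) x(1) by blast
  then have "k \<in> range g" using range_g by simp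
  then obtain i where "k = g i" by (rule rangeE)
  then have "g i x > 1" using k(2) by (simp add: D_def)
  then show False using x(2) by (meson not_le)
qed

end

section \<open>Smooth maps from homomorphisms\<close>

text \<open>
  Bump functions reduce continuity and smoothness of \<open>\<Phi>\<close> to properties of real-valued functions on \<open>M\<close>:
  a bump function \<open>b\<close> at \<open>\<Phi> x\<close> detects a neighbourhood of \<open>\<Phi> x\<close>, and near \<open>\<Phi> x\<close> a coordinate of a chart
  is the quotient of its globally smooth multiple by \<open>b\<close> and \<open>b\<close> itself.
\<close>

lemma smooth_mapsI_pullback:
  fixes M :: "'a manifold" and N :: "'b manifold"
  assumes "smooth_manifold M" "smooth_manifold N"
    and ext: "\<Phi> \<in> extensional (points M)" and \<Phi>: "\<And>x. x \<in> points M \<Longrightarrow> \<Phi> x \<in> points N"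
    and pullback: "\<And>f. f \<in> smooth_functions N \<Longrightarrow> compose (points M) f \<Phi> \<in> smooth_functions M"
  shows "\<Phi> \<in> smooth_maps M N"
proof -
  interpret M: smooth_mfd M by unfold_locales (rule assms(1))
  interpret N: smooth_mfd N by unfold_locales (rule assms(2))
  have preimage: "openin (mtopology M) {x \<in> points M. f (\<Phi> x) > c}" if "f \<in> smooth_functions N" for f c
  proof -
    have "{x \<in> points M. f (\<Phi> x) > c} = {x \<in> points M. compose (points M) f \<Phi> x > c}"
      by (auto simp: compose_def)
    then show ?thesis
      using M.openin_smooth_functions_greater[OF pullback[OF that]] by simp
  qed
  have cont: "continuous_map (mtopology M) (mtopology N) \<Phi>"
    unfolding continuous_map_alt
  proof (intro conjI allI impI)
    show "\<Phi> \<in> points M \<rightarrow> points N" using \<Phi> by blast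
    fix V assume V: "openin (mtopology N) V"
    show "openin (mtopology M) (\<Phi> -` V \<inter> points M)"
    proof (subst openin_subopen, intro ballI)
      fix x assume x: "x \<in> \<Phi> -` V \<inter> points M"
      then obtain b where b: "b \<in> smooth_functions N" "b (\<Phi> x) > 0" "\<And>y. y \<in> points N - V \<Longrightarrow> b y = 0"
        using N.bump_at[OF V, of "\<Phi> x"] by auto
      have "{y \<in> points M. b (\<Phi> y) > 0} \<subseteq> \<Phi> -` V \<inter> points M"
        using b(3) \<Phi> by force
      then show "\<exists>T. openin (mtopology M) T \<and> x \<in> T \<and> T \<subseteq> \<Phi> -` V \<inter> points M"
        using preimage[OF b(1), of 0] b(2) x
        by (intro exI[of _ "{y \<in> points M. b (\<Phi> y) > 0}"]) auto
    qed
  qed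
  have "smooth_on (mdim M) (u ` {x \<in> U. \<Phi> x \<in> V}) (\<lambda>y. (v \<circ> \<Phi> \<circ> inv_into U u) y j)"
    if U: "(U, u) \<in> matlas M" and V: "(V, v) \<in> matlas N" and j: "j < mdim N" for U u V v j
  proof -
    define S where "S = {x \<in> U. \<Phi> x \<in> V}"
    have "S = U \<inter> {x \<in> points M. \<Phi> x \<in> V}"
      using M.chart_subset[OF U] by (auto simp: S_def)
    then have S: "openin (mtopology M) S"
      using openin_continuous_map_preimage[OF cont N.chart_open[OF V]] M.chart_open[OF U] by auto
    have "smooth_on (mdim M) (u ` S) (\<lambda>y. (v \<circ> \<Phi> \<circ> inv_into U u) y j)"
    proof (rule smooth_on_local)
      show "openin (Euclidean_space (mdim M)) (u ` S)"
        by (rule M.chart_image_open[OF U S]) (auto simp: S_def)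
      fix y assume "y \<in> u ` S"
      then obtain x where x: "x \<in> S" "y = u x" by blast
      then have "x \<in> points M" "\<Phi> x \<in> V" "x \<in> U"
        using M.chart_subset[OF U] by (auto simp: S_def)
      then obtain b where b: "b (\<Phi> x) > 0"
        and b_smooth: "\<And>h. smooth_on (mdim N) (v ` V) (\<lambda>y. h (inv_into V v y)) \<Longrightarrow>
          (\<lambda>x\<in>points N. b x * h x) \<in> smooth_functions N"
        using N.bump_function[OF V N.chart_open[OF V], of "\<Phi> x"] by metis
      have oV: "openin (Euclidean_space (mdim N)) (v ` V)"
        by (rule N.chart_image_open[OF V N.chart_open[OF V]]) simp
      \<comment> \<open>Near \<open>\<Phi> x\<close> the coordinate \<open>j\<close> of \<open>v\<close> is the quotient of two globally smooth functions.\<close>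
      define f where "f = (\<lambda>x\<in>points N. b x * v x j)"
      define b1 where "b1 = (\<lambda>x\<in>points N. b x * 1)"
      have b1: "b1 \<in> smooth_functions N"
        unfolding b1_def by (rule b_smooth) (rule smooth_on_const)
      have f: "f \<in> smooth_functions N"
        unfolding f_def
      proof (rule b_smooth)
        show "smooth_on (mdim N) (v ` V) (\<lambda>y. v (inv_into V v y) j)"
          by (subst smooth_on_cong[OF oV, of _ "\<lambda>y. y j"]) (use V j smooth_on_coord in auto)
      qed
      define W where "W = S \<inter> {x \<in> points M. b1 (\<Phi> x) > 0}"
      have W: "openin (mtopology M) W" "W \<subseteq> U" "x \<in> W" "W \<subseteq> S" "W \<subseteq> points M"
      proof -
        show "openin (mtopology M) W"
          unfolding W_def by (rule openin_Int[OF S preimage[OF b1]])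
        show "x \<in> W"
          using x b \<open>x \<in> points M\<close> \<Phi> by (simp add: W_def b1_def)
      qed (auto simp: W_def S_def)
      have oW: "openin (Euclidean_space (mdim M)) (u ` W)"
        by (rule M.chart_image_open[OF U W(1,2)])
      have "smooth_on (mdim M) (u ` W) (\<lambda>y. compose (points M) f \<Phi> (inv_into U u y) *
          inverse (compose (points M) b1 \<Phi> (inv_into U u y)))"
      proof (intro smooth_on_mult smooth_on_inverse oW)
        show "compose (points M) b1 \<Phi> (inv_into U u y) \<noteq> 0" if "y \<in> u ` W" for y
          using that W(2,5) M.chart_inv[OF U] by (auto simp: compose_def W_def subset_iff)
      qed (use M.smooth_functionsD[OF pullback U W(2)] f b1 in auto)
      moreover have "(v \<circ> \<Phi> \<circ> inv_into U u) y j = compose (points M) f \<Phi> (inv_into U u y) *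
          inverse (compose (points M) b1 \<Phi> (inv_into U u y))" if y: "y \<in> u ` W" for y
      proof -
        obtain w where w: "w \<in> W" "y = u w" using y by blast
        then have "inv_into U u y = w" "w \<in> points M" "\<Phi> w \<in> points N" "b1 (\<Phi> w) > 0"
          using W(2,5) M.chart_inv[OF U] \<Phi> by (auto simp: W_def subset_iff)
        then show ?thesis
          by (simp add: compose_def f_def b1_def)
      qed
      ultimately have "smooth_on (mdim M) (u ` W) (\<lambda>y. (v \<circ> \<Phi> \<circ> inv_into U u) y j)"
        using smooth_on_cong[OF oW] by (metis (mono_tags, lifting))
      then show "\<exists>T. openin (Euclidean_space (mdim M)) T \<and> y \<in> T \<and> T \<subseteq> u ` S \<and>
          smooth_on (mdim M) T (\<lambda>y. (v \<circ> \<Phi> \<circ> inv_into U u) y j)"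
        using oW W x by (intro exI[of _ "u ` W"]) auto
    qed
    then show ?thesis by (simp only: S_def)
  qed
  then show ?thesis
    unfolding smooth_maps_def smooth_vec_on_def using ext cont by blast
qed

lemma (in smooth_mfd) smooth_functions_separate:
  assumes "p \<in> points M" "q \<in> points M" "\<And>f. f \<in> smooth_functions M \<Longrightarrow> f p = f q"
  shows "p = q"
proof (rule ccontr)
  assume "p \<noteq> q"
  have "Hausdorff_space (mtopology M)"
    using smooth_manifold by (simp add: smooth_manifold_def)
  then have "closedin (mtopology M) {q}"
    using assms(2) by (simp add: closedin_Hausdorff_singleton)
  then have o: "openin (mtopology M) (points M - {q})"
    by blast
  obtain b where b: "b \<in> smooth_functions M" "b p > 0"
    and b0: "\<And>x. x \<in> points M - (points M - {q}) \<Longrightarrow> b x = 0"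
    using bump_at[OF o, of p] assms(1) \<open>p \<noteq> q\<close> by blast
  have "b q = 0" using b0 assms(2) by blast
  then show False using assms(3)[OF b(1)] b(2) by simp
qed

theorem theorem5p8:
  fixes M :: "'a manifold" and N :: "'b manifold"
    and \<phi> :: "('b \<Rightarrow> real) \<Rightarrow> ('a \<Rightarrow> real)"
  assumes "smooth_manifold M" and "smooth_manifold N"
    and "\<phi> \<in> real_algebra_hom (Cinf N) (Cinf M)"
  shows "\<exists>!\<Phi>. \<Phi> \<in> smooth_maps M N \<and>
           (\<forall>f\<in>carrier (Cinf N). \<phi> f = compose (points M) f \<Phi>)"
proof -
  interpret M: smooth_mfd M by unfold_locales (rule assms(1))
  interpret N: smooth_mfd N by unfold_locales (rule assms(2))
  have hom: "\<phi> \<in> ring_hom (Cinf N) (Cinf M)"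
    and scale: "\<And>c f. f \<in> smooth_functions N \<Longrightarrow> \<phi> (\<lambda>x\<in>points N. c * f x) = (\<lambda>x\<in>points M. c * \<phi> f x)"
    using assms(3) by (auto simp: real_algebra_hom_def Cinf_def)
  have \<phi>_closed: "\<phi> f \<in> smooth_functions M" if "f \<in> smooth_functions N" for f
    using ring_hom_closed[OF hom, of f] that by (simp add: Cinf_def)
  have "\<exists>p\<in>points N. \<forall>f\<in>smooth_functions N. \<phi> f x = f p" if x: "x \<in> points M" for x
  proof -
    interpret smooth_mfd_character N "\<lambda>f. \<phi> f x"
    proof
      show "\<phi> (\<lambda>x\<in>points N. f x + g x) x = \<phi> f x + \<phi> g x"
        if "f \<in> smooth_functions N" "g \<in> smooth_functions N" for f g
        using ring_hom_add[OF hom, of f g] that x by (simp add: Cinf_def)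
      show "\<phi> (\<lambda>x\<in>points N. f x * g x) x = \<phi> f x * \<phi> g x"
        if "f \<in> smooth_functions N" "g \<in> smooth_functions N" for f g
        using ring_hom_mult[OF hom, of f g] that x by (simp add: Cinf_def)
      show "\<phi> (\<lambda>x\<in>points N. 1) x = 1"
        using ring_hom_one[OF hom] x by (simp add: Cinf_def)
      show "\<phi> (\<lambda>x\<in>points N. c * f x) x = c * \<phi> f x" if "f \<in> smooth_functions N" for c f
        using scale[OF that] x by simp
    qed
    show ?thesis by (rule character_is_evaluation)
  qed
  then obtain P where P: "\<And>x. x \<in> points M \<Longrightarrow> P x \<in> points N"
    "\<And>x f. x \<in> points M \<Longrightarrow> f \<in> smooth_functions N \<Longrightarrow> \<phi> f x = f (P x)"
    by metis
  define \<Phi> where "\<Phi> = restrict P (points M)"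
  have pullback: "\<phi> f = compose (points M) f \<Phi>" if "f \<in> smooth_functions N" for f
  proof (rule extensionalityI)
    show "\<phi> f \<in> extensional (points M)"
      using \<phi>_closed[OF that] by (simp add: smooth_functions_def)
    show "compose (points M) f \<Phi> \<in> extensional (points M)"
      by (rule compose_extensional)
    show "\<phi> f x = compose (points M) f \<Phi> x" if "x \<in> points M" for x
      using P(2)[OF that \<open>f \<in> smooth_functions N\<close>] that by (simp add: compose_def \<Phi>_def)
  qed
  have carrier: "carrier (Cinf N) = smooth_functions N"
    by (simp add: Cinf_def)
  show ?thesis
    unfolding carrier
  proof (rule ex1I[of _ \<Phi>], intro conjI ballI)
    show "\<Phi> \<in> smooth_maps M N"
      by (rule smooth_mapsI_pullback[OF assms(1,2)])
         (use P(1) \<phi>_closed pullback in \<open>auto simp: \<Phi>_def\<close>)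
    show "\<phi> f = compose (points M) f \<Phi>" if "f \<in> smooth_functions N" for f
      by (rule pullback[OF that])
    fix \<Psi> assume \<Psi>: "\<Psi> \<in> smooth_maps M N \<and> (\<forall>f\<in>smooth_functions N. \<phi> f = compose (points M) f \<Psi>)"
    show "\<Psi> = \<Phi>"
    proof (rule extensionalityI)
      show "\<Psi> \<in> extensional (points M)" "\<Phi> \<in> extensional (points M)"
        using \<Psi> by (auto simp: smooth_maps_def \<Phi>_def)
      fix x assume x: "x \<in> points M"
      show "\<Psi> x = \<Phi> x"
      proof (rule N.smooth_functions_separate)
        show "\<Psi> x \<in> points N"
          using \<Psi> x continuous_map_image_subset_topspace by (fastforce simp: smooth_maps_def)
        show "\<Phi> x \<in> points N"
          using P(1) x by (simp add: \<Phi>_def)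
        fix f assume "f \<in> smooth_functions N"
        then have "compose (points M) f \<Psi> = compose (points M) f \<Phi>"
          using \<Psi> pullback by auto
        from fun_cong[OF this, of x] show "f (\<Psi> x) = f (\<Phi> x)"
          using x by (simp add: compose_def)
      qed
    qed
  qed
qed

end
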